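(* Let $\Omega\subseteq\mathbb{C}$ be a connected open set and let $T=((T_{i,j}))_{n\times n}$ and $\tilde T=((\tilde T_{i,j}))_{n\times n}$ be two operators in $\mathcal{FB}_n(\Omega)$ such that $T_{i,j}=0$ and $\tilde T_{i,j}=0$ whenever $j-i\ge 2$. For $1\le i\le n$ let $t_i$ and $\tilde t_i$ be non-vanishing holomorphic sections of $E_{T_{i,i}}$ and $E_{\tilde T_{i,i}}$, respectively, with $t_i(w)=T_{i,i+1}t_{i+1}(w)$ and $\tilde t_i(w)=\tilde T_{i,i+1}\tilde t_{i+1}(w)$ for $1\le i\le n-1$ and $w\in\Omega$. Then $T$ and $\tilde T$ are unitarily equivalent if and only if the following two conditions hold on $\Omega$: (1) $\mathcal{K}_{T_{n,n}}=\mathcal{K}_{\tilde T_{n,n}}$; (2) $\dfrac{\|t_i\|}{\|\tilde t_i\|}=\dfrac{\|t_{i+1}\|}{\|\tilde t_{i+1}\|}$ for $1\le i\le n-1$.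
   Context: All Hilbert spaces are complex and separable; $\mathcal{L}(\mathcal{H})$ is the algebra of bounded linear operators on $\mathcal{H}$. For a positive integer $n$, the Cowen-Douglas class $\mathcal{B}_n(\Omega)$ consists of the bounded operators $T$ on a Hilbert space $\mathcal{H}$ such that: (1) $\Omega\subset\sigma(T)$; (2) $\mathrm{ran}(T-w)=\mathcal{H}$ for all $w\in\Omega$; (3) the closed linear span of $\bigcup_{w\in\Omega}\ker(T-w)$ is $\mathcal{H}$; (4) $\dim\ker(T-w)=n$ for all $w\in\Omega$. For $T\in\mathcal{B}_n(\Omega)$, $E_T$ is the Hermitian holomorphic vector bundle over $\Omega$ with fibre $\ker(T-w)$ at $w$; a holomorphic section of $E_T$ is a holomorphic map $\gamma:\Omega\to\mathcal{H}$ with $\gamma(w)\in\ker(T-w)$. For $T\in\mathcal{B}_1(\Omega)$ the curvature is $\mathcal{K}_T(w)=-\frac{\partial^2}{\partial\bar w\,\partial w}\log\|\gamma(w)\|^2$, where $\gamma$ is any non-vanishing holomorphic section of $E_T$. $\mathcal{FB}_n(\Omega)$ is the collection of all bounded operators $T$ on a Hilbert space $\mathcal{H}=\mathcal{H}_1\oplus\cdots\oplus\mathcal{H}_n$ that are upper-triangular $n\times n$ operator matrices $T=((T_{i,j}))$ (with $T_{i,j}:\mathcal{H}_j\to\mathcal{H}_i$ and $T_{i,j}=0$ for $i>j$), where each $T_{i,i}\in\mathcal{L}(\mathcal{H}_i)$ is in $\mathcal{B}_1(\Omega)$ and each $T_{i,i+1}$, $1\le i\le n-1$, is a non-zero bounded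 operator with $T_{i,i}T_{i,i+1}=T_{i,i+1}T_{i+1,i+1}$. *)

theory Defs
  imports "HOL-Analysis.Analysis"
begin

section \<open>Separable complex Hilbert spaces\<close>

text \<open>
  The inner product is linear in the first argument. Its real part is the real inner product of the
  underlying real Hilbert space, so norm, topology and completeness are those of the library;
  for a metric space, second countability is separability.
\<close>

class complex_hilbert_space = real_inner + complete_space + second_countable_topology +
  fixes scaleC :: "complex \<Rightarrow> 'a \<Rightarrow> 'a" (infixr "*\<^sub>C" 75)
    and cinner :: "'a \<Rightarrow> 'a \<Rightarrow> complex"
  assumes scaleC_add_right: "a *\<^sub>C (x + y) = a *\<^sub>C x + a *\<^sub>C y"
    and scaleC_add_left: "(a + b) *\<^sub>C x = a *\<^sub>C x + b *\<^sub>C x"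
    and scaleC_scaleC: "a *\<^sub>C (b *\<^sub>C x) = (a * b) *\<^sub>C x"
    and scaleC_of_real: "complex_of_real r *\<^sub>C x = r *\<^sub>R x"
    and cinner_add_left: "cinner (x + y) z = cinner x z + cinner y z"
    and cinner_scaleC_left: "cinner (a *\<^sub>C x) y = a * cinner x y"
    and cinner_commute: "cinner x y = cnj (cinner y x)"
    and Re_cinner: "Re (cinner x y) = inner x y"

global_interpretation complex_vector:
  vector_space "scaleC :: complex \<Rightarrow> 'a \<Rightarrow> 'a::complex_hilbert_space"
proof
  fix a b :: complex and x y :: 'a
  show "a *\<^sub>C (x + y) = a *\<^sub>C x + a *\<^sub>C y" by (rule scaleC_add_right)
  show "(a + b) *\<^sub>C x = a *\<^sub>C x + b *\<^sub>C x" by (rule scaleC_add_left)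
  show "a *\<^sub>C (b *\<^sub>C x) = (a * b) *\<^sub>C x" by (rule scaleC_scaleC)
  show "1 *\<^sub>C x = x" using scaleC_of_real[of 1 x] by simp
qed

text \<open>Hilbert spaces also occur as closed complex subspaces of a given one.\<close>

definition closed_csubspace :: "'a::complex_hilbert_space set \<Rightarrow> bool" where
  "closed_csubspace M \<longleftrightarrow> complex_vector.subspace M \<and> closed M"

text \<open>Bounded complex-linear operators from \<open>M\<close> to \<open>N\<close>; values outside \<open>M\<close> are irrelevant.\<close>

definition bounded_operator ::
    "'a::complex_hilbert_space set \<Rightarrow> 'b::complex_hilbert_space set \<Rightarrow> ('a \<Rightarrow> 'b) \<Rightarrow> bool" where
  "bounded_operator M N f \<longleftrightarrow>
     (\<forall>x\<in>M. f x \<in> N) \<and>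
     (\<forall>x\<in>M. \<forall>y\<in>M. f (x + y) = f x + f y) \<and>
     (\<forall>a. \<forall>x\<in>M. f (a *\<^sub>C x) = a *\<^sub>C f x) \<and>
     (\<exists>K. \<forall>x\<in>M. norm (f x) \<le> K * norm x)"

definition op_spectrum :: "'a::complex_hilbert_space set \<Rightarrow> ('a \<Rightarrow> 'a) \<Rightarrow> complex set" where
  "op_spectrum M f =
     {w. \<not> (\<exists>g. bounded_operator M M g \<and>
             (\<forall>x\<in>M. g (f x - w *\<^sub>C x) = x \<and> f (g x) - w *\<^sub>C g x = x))}"

definition eigenspace :: "'a::complex_hilbert_space set \<Rightarrow> ('a \<Rightarrow> 'a) \<Rightarrow> complex \<Rightarrow> 'a set" where
  "eigenspace M f w = {x\<in>M. f x - w *\<^sub>C x = 0}"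

definition unitary :: "('a::complex_hilbert_space \<Rightarrow> 'b::complex_hilbert_space) \<Rightarrow> bool" where
  "unitary U \<longleftrightarrow> bounded_operator UNIV UNIV U \<and> surj U \<and> (\<forall>x y. cinner (U x) (U y) = cinner x y)"

definition unitarily_equivalent ::
    "('a::complex_hilbert_space \<Rightarrow> 'a) \<Rightarrow> ('b::complex_hilbert_space \<Rightarrow> 'b) \<Rightarrow> bool" where
  "unitarily_equivalent S T \<longleftrightarrow> (\<exists>U. unitary U \<and> (\<forall>x. U (S x) = T (U x)))"


section \<open>The Cowen-Douglas class and its curvature\<close>

text \<open>Since \<open>n\<close> is positive, the condition on \<open>dim\<close> forces the eigenspaces to be
  finite-dimensional (\<open>dim\<close> is \<open>0\<close> in infinite dimension).\<close>

definition cowen_douglas ::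
    "nat \<Rightarrow> complex set \<Rightarrow> 'a::complex_hilbert_space set \<Rightarrow> ('a \<Rightarrow> 'a) \<Rightarrow> bool" where
  "cowen_douglas n \<Omega> M f \<longleftrightarrow>
     0 < n \<and> closed_csubspace M \<and> bounded_operator M M f \<and>
     \<Omega> \<subseteq> op_spectrum M f \<and>
     (\<forall>w\<in>\<Omega>. (\<lambda>x. f x - w *\<^sub>C x) ` M = M) \<and>
     closure (complex_vector.span (\<Union>w\<in>\<Omega>. eigenspace M f w)) = M \<and>
     (\<forall>w\<in>\<Omega>. complex_vector.dim (eigenspace M f w) = n)"

definition vector_holomorphic_on ::
    "(complex \<Rightarrow> 'a::complex_hilbert_space) \<Rightarrow> complex set \<Rightarrow> bool" where
  "vector_holomorphic_on \<gamma> \<Omega> \<longleftrightarrow>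
     (\<forall>w\<in>\<Omega>. \<exists>d. (\<gamma> has_derivative (\<lambda>h. h *\<^sub>C d)) (at w within \<Omega>))"

definition nonvanishing_section ::
    "complex set \<Rightarrow> 'a::complex_hilbert_space set \<Rightarrow> ('a \<Rightarrow> 'a) \<Rightarrow> (complex \<Rightarrow> 'a) \<Rightarrow> bool" where
  "nonvanishing_section \<Omega> M f \<gamma> \<longleftrightarrow>
     vector_holomorphic_on \<gamma> \<Omega> \<and> (\<forall>w\<in>\<Omega>. \<gamma> w \<in> eigenspace M f w \<and> \<gamma> w \<noteq> 0)"

text \<open>The Wirtinger derivatives
  \<open>\<partial>/\<partial>w = (\<partial>/\<partial>x - \<i> \<partial>/\<partial>y) / 2\<close> and \<open>\<partial>/\<partial>w\<^bold>* = (\<partial>/\<partial>x + \<i> \<partial>/\<partial>y) / 2\<close>,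
  where \<open>w\<^bold>*\<close> is the complex conjugate of \<open>w = x + \<i> y\<close>.\<close>

definition wirtinger :: "(complex \<Rightarrow> complex) \<Rightarrow> complex \<Rightarrow> complex" where
  "wirtinger u w =
     (frechet_derivative u (at w) 1 - \<i> * frechet_derivative u (at w) \<i>) / 2"

definition wirtinger_bar :: "(complex \<Rightarrow> complex) \<Rightarrow> complex \<Rightarrow> complex" where
  "wirtinger_bar u w =
     (frechet_derivative u (at w) 1 + \<i> * frechet_derivative u (at w) \<i>) / 2"

definition section_curvature :: "(complex \<Rightarrow> 'a::complex_hilbert_space) \<Rightarrow> complex \<Rightarrow> complex" where
  "section_curvature \<gamma> w =
     - wirtinger_bar (wirtinger (\<lambda>z. complex_of_real (ln ((norm (\<gamma> z))\<^sup>2)))) w"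

text \<open>For an operator in the class with \<open>n = 1\<close> and open \<open>\<Omega>\<close>, the value on \<open>\<Omega>\<close> is the same for
  every non-vanishing section: two sections differ by a holomorphic factor without zeros, and the
  logarithm of its modulus is harmonic.\<close>

definition curvature ::
    "complex set \<Rightarrow> 'a::complex_hilbert_space set \<Rightarrow> ('a \<Rightarrow> 'a) \<Rightarrow> complex \<Rightarrow> complex" where
  "curvature \<Omega> M f = section_curvature (SOME \<gamma>. nonvanishing_section \<Omega> M f \<gamma>)"


section \<open>Operator matrices and the class \<open>FB\<close>\<close>

text \<open>\<open>H\<^sub>1 \<oplus> \<dots> \<oplus> H\<^sub>n\<close> is the whole space, as an internal orthogonal direct sum of closed subspaces.\<close>

definition orthogonal_decomposition :: "nat \<Rightarrow> (nat \<Rightarrow> 'a::complex_hilbert_space set) \<Rightarrow> bool" where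
  "orthogonal_decomposition n H \<longleftrightarrow>
     (\<forall>i\<in>{1..n}. closed_csubspace (H i)) \<and>
     (\<forall>i\<in>{1..n}. \<forall>j\<in>{1..n}. i \<noteq> j \<longrightarrow> (\<forall>x\<in>H i. \<forall>y\<in>H j. cinner x y = 0)) \<and>
     (\<forall>x. \<exists>y. (\<forall>i\<in>{1..n}. y i \<in> H i) \<and> x = (\<Sum>i=1..n. y i))"

definition orth_proj :: "'a::complex_hilbert_space set \<Rightarrow> 'a \<Rightarrow> 'a" where
  "orth_proj M x = (THE y. y \<in> M \<and> (\<forall>z\<in>M. cinner (x - y) z = 0))"

text \<open>The entry \<open>T\<^sub>i\<^sub>j : H\<^sub>j \<rightarrow> H\<^sub>i\<close>, extended by zero on the orthogonal complement of \<open>H\<^sub>j\<close>.\<close>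

definition matrix_entry ::
    "(nat \<Rightarrow> 'a::complex_hilbert_space set) \<Rightarrow> ('a \<Rightarrow> 'a) \<Rightarrow> nat \<Rightarrow> nat \<Rightarrow> 'a \<Rightarrow> 'a" where
  "matrix_entry H T i j x = orth_proj (H i) (T (orth_proj (H j) x))"

definition FB_class ::
    "nat \<Rightarrow> complex set \<Rightarrow> (nat \<Rightarrow> 'a::complex_hilbert_space set) \<Rightarrow> ('a \<Rightarrow> 'a) \<Rightarrow> bool" where
  "FB_class n \<Omega> H T \<longleftrightarrow>
     orthogonal_decomposition n H \<and> bounded_operator UNIV UNIV T \<and>
     (\<forall>i\<in>{1..n}. \<forall>j\<in>{1..n}. j < i \<longrightarrow> (\<forall>x\<in>H j. matrix_entry H T i j x = 0)) \<and>
     (\<forall>i\<in>{1..n}. cowen_douglas 1 \<Omega> (H i) (matrix_entry H T i i)) \<and>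
     (\<forall>i\<in>{1..<n}.
        (\<exists>x\<in>H (i + 1). matrix_entry H T i (i + 1) x \<noteq> 0) \<and>
        (\<forall>x\<in>H (i + 1). matrix_entry H T i i (matrix_entry H T i (i + 1) x) =
                         matrix_entry H T i (i + 1) (matrix_entry H T (i + 1) (i + 1) x)))"

end

theory Submission
  imports Defs "HOL-Complex_Analysis.Complex_Analysis"
begin

text \<open>
  A bidiagonal operator \<open>T\<close> in the class \<open>FB\<close> is a sum \<open>D + N\<close> of its diagonal and superdiagonal
  parts, and the intertwining relations in the definition of the class say exactly that \<open>D\<close> and \<open>N\<close>
  commute. On the sections, \<open>D t\<^sub>i(w) = w t\<^sub>i(w)\<close> and \<open>N t\<^sub>i\<^sub>+\<^sub>1 = t\<^sub>i\<close>, and the vectors \<open>t\<^sub>i(w)\<close> span a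
  dense subspace of \<open>H\<^sub>i\<close>.

  \<^emph>\<open>From the invariants to the equivalence.\<close> Equality of the curvatures means that
  \<open>log |t\<^sub>n|\<^sup>2 - log |t'\<^sub>n|\<^sup>2\<close> is harmonic, so that \<open>|t\<^sub>n| = |\<phi>| |t'\<^sub>n|\<close> on a disc with a holomorphic
  \<open>\<phi>\<close> without zeros (\<open>norm_proportional_of_curvature_eq\<close>). By the second condition the same \<open>\<phi>\<close>
  serves for every \<open>i\<close>. A kernel that is holomorphic in one variable and antiholomorphic
  in the other is determined by its diagonal (\<open>cinner_eq_of_norm_eq\<close>), so the families
  \<open>t\<^sub>i(w)\<close> and \<open>\<phi>(w) t'\<^sub>i(w)\<close> over the disc have the same Gram matrix. Both span dense subspaces by the
  identity theorem, hence there is a unitary operator mapping one to the other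
  (\<open>unitary_of_gram\<close>), and it intertwines \<open>T\<close> and \<open>T'\<close>.

  \<^emph>\<open>From the equivalence to the invariants.\<close> The main point is that a unitary \<open>U\<close> with \<open>U T = T' U\<close>
  maps each \<open>H\<^sub>k\<close> onto \<open>H'\<^sub>k\<close>; then it intertwines \<open>D\<close> with \<open>D'\<close> and \<open>N\<close> with \<open>N'\<close>, so
  \<open>U t\<^sub>n = \<psi> t'\<^sub>n\<close> with \<open>\<psi>\<close> holomorphic, and applying powers of \<open>N\<close> gives \<open>U t\<^sub>i = \<psi> t'\<^sub>i\<close> for all \<open>i\<close>
  (\<open>unitary_sections\<close>). Both conditions follow, since \<open>log |\<psi>|\<^sup>2\<close> is harmonic.

  To see that \<open>U\<close> respects the decompositions, consider any bounded \<open>X\<close> commuting with \<open>T\<close>. It is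
  upper triangular (\<open>block_lower\<close>): on the lowest non-zero subdiagonal its blocks would intertwine the
  diagonal entries of \<open>T\<close> and so act on the sections by scalars, while the next diagonal
  exhibits these scalars as eigenvalues of a commutator \<open>[D, W]\<close> that itself commutes with \<open>D\<close>. As
  in the theorem of Kleinecke and Shirokov, such an eigenvalue is zero
  (\<open>commutator_eigenvalue_eq_0\<close>). If \<open>X\<close> is also nilpotent, its diagonal blocks vanish, and \<open>X\<close>
  maps each space of the flag \<open>H\<^sub>1 \<oplus> \<dots> \<oplus> H\<^sub>k\<close> into the preceding one (\<open>nilpotent_lowers_flag\<close>). This applies to
  \<open>X = U\<^sup>* N' U\<close>. Since \<open>t'\<^sub>k = N'\<^sup>n\<^sup>-\<^sup>k t'\<^sub>n\<close>, the operator \<open>U\<^sup>*\<close> maps the flag of \<open>T'\<close> into the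
  flag of \<open>T\<close> (\<open>equivalence_maps_flag\<close>). By symmetry \<open>U\<close> maps the flag of \<open>T\<close> into that of \<open>T'\<close>,
  and a unitary operator preserving the flags preserves their orthogonal differences
  (\<open>unitary_component\<close>).
\<close>

section \<open>Complex inner product spaces\<close>

instance complex_hilbert_space \<subseteq> banach ..

lemma scaleC_simps [simp]:
  fixes x :: "'a::complex_hilbert_space"
  shows "0 *\<^sub>C x = 0" "a *\<^sub>C (0::'a) = 0" "1 *\<^sub>C x = x"
    "(- a) *\<^sub>C x = - (a *\<^sub>C x)" "a *\<^sub>C (- x) = - (a *\<^sub>C x)"
    "a *\<^sub>C b *\<^sub>C x = (a * b) *\<^sub>C x"
  by (simp_all add: scaleC_scaleC)

lemma cinner_linear_simps [simp]:
  fixes x y z :: "'a::complex_hilbert_space"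
  shows "cinner 0 y = 0" "cinner x 0 = 0"
    "cinner (- x) y = - cinner x y" "cinner x (- y) = - cinner x y"
    "cinner (a *\<^sub>C x) y = a * cinner x y" "cinner x (a *\<^sub>C y) = cnj a * cinner x y"
proof -
  have z: "cinner (0::'a) y = 0" for y
    using cinner_scaleC_left[of 0 0 y] by simp
  have m: "cinner (- x) y = - cinner x y" for x y :: 'a
    using cinner_scaleC_left[of "-1" x y] by simp
  show "cinner 0 y = 0" "cinner (- x) y = - cinner x y" "cinner (a *\<^sub>C x) y = a * cinner x y"
    by (rule z m cinner_scaleC_left)+
  show "cinner x 0 = 0" using z[of x] cinner_commute[of x 0] by simp
  show "cinner x (- y) = - cinner x y" 
    using m[of y x] cinner_commute[of x "- y"] cinner_commute[of x y] by simp
  show "cinner x (a *\<^sub>C y) = cnj a * cinner x y"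
    using cinner_scaleC_left[of a y x] cinner_commute[of x "a *\<^sub>C y"] cinner_commute[of x y] by simp
qed

lemma cinner_add_right: "cinner x (y + z) = cinner x y + cinner x z"
  using cinner_add_left[of y z x] cinner_commute[of x "y + z"] cinner_commute[of x y]
    cinner_commute[of x z] by simp

lemma cinner_diff_left: "cinner (x - y) z = cinner x z - cinner y z"
  using cinner_add_left[of x "- y" z] by simp

lemma cinner_sum_left: "cinner (\<Sum>i\<in>I. f i) y = (\<Sum>i\<in>I. cinner (f i) y)"
  by (induction I rule: infinite_finite_induct) (auto simp: cinner_add_left)

lemma cinner_sum_right: "cinner y (\<Sum>i\<in>I. f i) = (\<Sum>i\<in>I. cinner y (f i))"
  by (induction I rule: infinite_finite_induct) (auto simp: cinner_add_right)

lemma cinner_self: "cinner x x = complex_of_real ((norm x)\<^sup>2)"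
proof (rule complex_eqI)
  show "Re (cinner x x) = Re (complex_of_real ((norm x)\<^sup>2))"
    by (simp add: Re_cinner power2_norm_eq_inner)
  have "Im (cinner x x) = - Im (cinner x x)"
    using arg_cong[OF cinner_commute[of x x], of Im] by simp
  then show "Im (cinner x x) = Im (complex_of_real ((norm x)\<^sup>2))" by simp
qed

lemma cinner_self_eq_0 [simp]: "cinner x x = 0 \<longleftrightarrow> x = 0"
  by (simp add: cinner_self)

lemma norm_scaleC [simp]: "norm (a *\<^sub>C x) = cmod a * norm x"
proof -
  have "complex_of_real ((norm (a *\<^sub>C x))\<^sup>2) = a * cnj a * cinner x x"
    unfolding cinner_self[symmetric] by simp
  also have "\<dots> = complex_of_real ((cmod a * norm x)\<^sup>2)"
    using complex_norm_square[of a] by (simp add: cinner_self power_mult_distrib)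
  finally have "complex_of_real ((norm (a *\<^sub>C x))\<^sup>2) = complex_of_real ((cmod a * norm x)\<^sup>2)" .
  then have "(norm (a *\<^sub>C x))\<^sup>2 = (cmod a * norm x)\<^sup>2" by (simp only: of_real_eq_iff)
  then show ?thesis by (simp add: power2_eq_iff_nonneg)
qed

text \<open>Rotating the first argument makes the inner product real and positive, which reduces the
  complex Cauchy--Schwarz inequality to the real one.\<close>

lemma norm_cinner_le: "cmod (cinner x y) \<le> norm x * norm y"
proof -
  let ?c = "cinner x y"
  have "cmod ?c = Re (cnj (sgn ?c) * ?c)"
  proof (cases "?c = 0")
    case False
    have "cnj ?c * ?c = complex_of_real ((cmod ?c)\<^sup>2)"
      using complex_norm_square[of ?c] by (simp add: mult.commute)
    then have "cnj (sgn ?c) * ?c = complex_of_real (cmod ?c)"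
      using False by (simp add: sgn_eq power2_eq_square)
    then show ?thesis by simp
  qed simp
  also have "\<dots> = inner (cnj (sgn ?c) *\<^sub>C x) y"
    by (simp flip: Re_cinner)
  also have "\<dots> \<le> norm (cnj (sgn ?c) *\<^sub>C x) * norm y" by (rule norm_cauchy_schwarz)
  also have "\<dots> \<le> norm x * norm y"
    by (intro mult_right_mono) (auto simp: norm_sgn)
  finally show ?thesis .
qed

lemma scaleR_conv_scaleC: "r *\<^sub>R x = complex_of_real r *\<^sub>C x"
  by (simp add: scaleC_of_real)

lemma bounded_bilinear_cinner: "bounded_bilinear cinner"
proof
  show "\<exists>K. \<forall>a b. norm (cinner a b) \<le> norm a * norm b * K"
    by (intro exI[of _ 1]) (simp add: norm_cinner_le)
qed (auto simp: cinner_add_left cinner_add_right scaleR_conv_scaleC scaleR_conv_of_real)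

lemma bounded_bilinear_scaleC: "bounded_bilinear scaleC"
proof
  show "\<exists>K. \<forall>(a::complex) b::'a. norm (a *\<^sub>C b) \<le> norm a * norm b * K"
    by (intro exI[of _ 1]) simp
qed (auto simp: scaleC_add_left scaleC_add_right scaleR_conv_scaleC scaleR_conv_of_real mult_ac)

lemmas tendsto_cinner [tendsto_intros] = bounded_bilinear.tendsto[OF bounded_bilinear_cinner]
lemmas tendsto_scaleC [tendsto_intros] = bounded_bilinear.tendsto[OF bounded_bilinear_scaleC]
lemmas has_derivative_cinner = bounded_bilinear.FDERIV[OF bounded_bilinear_cinner]
lemmas has_derivative_scaleC = bounded_bilinear.FDERIV[OF bounded_bilinear_scaleC]

section \<open>Bounded complex-linear operators\<close>

abbreviation bounded_clinear :: "('a::complex_hilbert_space \<Rightarrow> 'b::complex_hilbert_space) \<Rightarrow> bool"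
  where "bounded_clinear \<equiv> bounded_operator UNIV UNIV"

lemma bounded_clinear_iff:
  "bounded_clinear f \<longleftrightarrow> bounded_linear f \<and> (\<forall>a x. f (a *\<^sub>C x) = a *\<^sub>C f x)"
proof
  assume f: "bounded_clinear f"
  then obtain K where "\<forall>x. norm (f x) \<le> K * norm x" by (auto simp: bounded_operator_def)
  with f have "bounded_linear f"
    by (intro bounded_linear_intro[where K = K])
      (auto simp: bounded_operator_def scaleR_conv_scaleC mult.commute)
  with f show "bounded_linear f \<and> (\<forall>a x. f (a *\<^sub>C x) = a *\<^sub>C f x)"
    by (simp add: bounded_operator_def)
next
  assume f: "bounded_linear f \<and> (\<forall>a x. f (a *\<^sub>C x) = a *\<^sub>C f x)"
  then obtain K where "\<forall>x. norm (f x) \<le> norm x * K" using bounded_linear.bounded by blast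
  with f show "bounded_clinear f"
    by (auto simp: bounded_operator_def linear_simps mult.commute)
qed

lemma bounded_clinear_linear: "bounded_clinear f \<Longrightarrow> bounded_linear f"
  and bounded_clinear_scaleC: "bounded_clinear f \<Longrightarrow> f (a *\<^sub>C x) = a *\<^sub>C f x"
  and bounded_clinear_add: "bounded_clinear f \<Longrightarrow> f (x + y) = f x + f y"
  and bounded_clinear_diff: "bounded_clinear f \<Longrightarrow> f (x - y) = f x - f y"
  and bounded_clinear_0: "bounded_clinear f \<Longrightarrow> f 0 = 0"
  and bounded_clinear_sum: "bounded_clinear f \<Longrightarrow> f (\<Sum>i\<in>I. g i) = (\<Sum>i\<in>I. f (g i))"
  by (auto simp: bounded_clinear_iff linear_simps linear_sum bounded_linear.linear)

lemma bounded_clinear_compose: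
  "bounded_clinear f \<Longrightarrow> bounded_clinear g \<Longrightarrow> bounded_clinear (\<lambda>x. f (g x))"
  by (auto simp: bounded_clinear_iff bounded_linear_compose)

lemma bounded_clinear_pow:
  fixes f :: "'a::complex_hilbert_space \<Rightarrow> 'a"
  shows "bounded_clinear f \<Longrightarrow> bounded_clinear (f ^^ k)"
proof (induction k)
  case 0
  show ?case using bounded_linear_ident by (auto simp: bounded_clinear_iff id_def)
next
  case (Suc k)
  then show ?case using bounded_clinear_compose[of f "f ^^ k"] by (simp add: comp_def)
qed

lemma bounded_clinear_zero: "bounded_clinear (\<lambda>x. 0)"
  by (simp add: bounded_clinear_iff)

lemma bounded_clinear_plus:
  "bounded_clinear f \<Longrightarrow> bounded_clinear g \<Longrightarrow> bounded_clinear (\<lambda>x. f x + g x)"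
  by (auto simp: bounded_clinear_iff bounded_linear_add scaleC_add_right)

lemma bounded_clinear_sub:
  "bounded_clinear f \<Longrightarrow> bounded_clinear g \<Longrightarrow> bounded_clinear (\<lambda>x. f x - g x)"
  by (auto simp: bounded_clinear_iff bounded_linear_sub complex_vector.scale_right_diff_distrib)

lemma bounded_clinear_scale: "bounded_clinear (\<lambda>x. a *\<^sub>C x)"
  using bounded_bilinear.bounded_linear_right[OF bounded_bilinear_scaleC, of a]
  by (auto simp: bounded_clinear_iff mult.commute)

lemma bounded_clinear_sum_fun:
  "(\<And>i. i \<in> I \<Longrightarrow> bounded_clinear (f i)) \<Longrightarrow> bounded_clinear (\<lambda>x. \<Sum>i\<in>I. f i x)"
  by (induction I rule: infinite_finite_induct)
    (auto simp: bounded_clinear_zero bounded_clinear_plus)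

lemma bounded_clinear_continuous_on: "bounded_clinear f \<Longrightarrow> continuous_on S f"
  by (simp add: bounded_clinear_linear linear_continuous_on)

lemma bounded_clinear_image_span:
  assumes "bounded_clinear f" "x \<in> complex_vector.span S" "complex_vector.subspace M"
    "\<And>y. y \<in> S \<Longrightarrow> f y \<in> M"
  shows "f x \<in> M"
  using assms(2)
proof (induction rule: complex_vector.span_induct_alt)
  case base
  then show ?case using assms(1,3) by (simp add: bounded_clinear_0 complex_vector.subspace_0)
next
  case (step c x y)
  then show ?case using assms
    by (simp add: bounded_clinear_add bounded_clinear_scaleC complex_vector.subspace_add
        complex_vector.subspace_scale)
qed

text \<open>The preimage of a closed subspace under a bounded operator is a closed subspace. Different
  choices of \<open>M\<close> turn this into equality of operators, orthogonality, or invariance of flags.\<close>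

lemma bounded_clinear_closure_span:
  assumes f: "bounded_clinear f" and x: "x \<in> closure (complex_vector.span S)"
    and M: "closed_csubspace M" and S: "\<And>y. y \<in> S \<Longrightarrow> f y \<in> M"
  shows "f x \<in> M"
proof -
  have "closed (f -` M)"
    using continuous_closed_vimage[of M f] bounded_clinear_continuous_on[OF f, of UNIV] M
    by (simp add: closed_csubspace_def continuous_on_eq_continuous_at)
  moreover have "complex_vector.span S \<subseteq> f -` M"
    using bounded_clinear_image_span[OF f _ _ S] M by (auto simp: closed_csubspace_def)
  ultimately have "closure (complex_vector.span S) \<subseteq> f -` M" by (simp add: closure_minimal)
  then show ?thesis using x by blast
qed

lemma closed_csubspace_zero: "closed_csubspace {0}"
  by (simp add: closed_csubspace_def complex_vector.subspace_def)

lemma bounded_clinear_eq_on_closure_span: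
  assumes "bounded_clinear f" "bounded_clinear g" "x \<in> closure (complex_vector.span S)"
    and "\<And>y. y \<in> S \<Longrightarrow> f y = g y"
  shows "f x = g x"
  using bounded_clinear_closure_span[OF bounded_clinear_sub[OF assms(1,2)] assms(3)
      closed_csubspace_zero] assms(4) by simp

lemma closed_csubspace_orthogonal: "closed_csubspace {x. cinner x y = 0}"
proof -
  have "{x. cinner x y = 0} = (\<lambda>x. cinner x y) -` {0}" by auto
  moreover have "closed ((\<lambda>x. cinner x y) -` {0})"
    by (rule continuous_closed_vimage)
      (auto intro!: bounded_bilinear.continuous[OF bounded_bilinear_cinner])
  ultimately show ?thesis
    by (auto simp: closed_csubspace_def complex_vector.subspace_def cinner_add_left)
qed

lemma closed_csubspace_closure_span: "closed_csubspace (closure (complex_vector.span S))"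
proof -
  let ?V = "complex_vector.span S" let ?M = "closure ?V"
  have "x + y \<in> ?M" if "x \<in> ?M" "y \<in> ?M" for x y
  proof -
    from that obtain f g where fg: "\<forall>n. f n \<in> ?V" "f \<longlonglongrightarrow> x" "\<forall>n. g n \<in> ?V" "g \<longlonglongrightarrow> y"
      by (auto simp: closure_sequential)
    then have "(\<lambda>n. f n + g n) \<longlonglongrightarrow> x + y" by (intro tendsto_add)
    moreover have "\<forall>n. f n + g n \<in> ?V" using fg by (auto intro: complex_vector.span_add)
    ultimately show ?thesis by (auto simp: closure_sequential)
  qed
  moreover have "a *\<^sub>C x \<in> ?M" if "x \<in> ?M" for a x
  proof -
    from that obtain f where f: "\<forall>n. f n \<in> ?V" "f \<longlonglongrightarrow> x" by (auto simp: closure_sequential)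
    then have "(\<lambda>n. a *\<^sub>C f n) \<longlonglongrightarrow> a *\<^sub>C x" by (intro tendsto_scaleC tendsto_const)
    moreover have "\<forall>n. a *\<^sub>C f n \<in> ?V" using f by (auto intro: complex_vector.span_scale)
    ultimately show ?thesis by (auto simp: closure_sequential)
  qed
  moreover have "0 \<in> ?M" using closure_subset complex_vector.span_zero by blast
  ultimately show ?thesis by (simp add: closed_csubspace_def complex_vector.subspace_def)
qed

section \<open>Dense subspaces and unitary operators\<close>

text \<open>A minimising sequence for the distance from \<open>x\<close> to a closed subspace is Cauchy by the
  parallelogram law, and the difference between \<open>x\<close> and its limit is orthogonal to the subspace.\<close>

lemma exists_orthogonal_vector:
  fixes x :: "'a::complex_hilbert_space"
  assumes M: "closed_csubspace M" and x: "x \<notin> M"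
  obtains y where "y \<noteq> 0" "\<And>m. m \<in> M \<Longrightarrow> cinner m y = 0"
proof -
  have sub: "complex_vector.subspace M" and cl: "closed M"
    using M by (auto simp: closed_csubspace_def)
  let ?S = "(\<lambda>m. (norm (x - m))\<^sup>2) ` M" let ?\<delta> = "Inf ?S"
  have ne: "?S \<noteq> {}" and bdd: "bdd_below ?S"
    using complex_vector.subspace_0[OF sub] by (auto intro: bdd_belowI[of _ 0])
  have le: "?\<delta> \<le> (norm (x - m))\<^sup>2" if "m \<in> M" for m using that bdd by (auto intro: cInf_lower)
  have "\<exists>m\<in>M. (norm (x - m))\<^sup>2 < ?\<delta> + 1 / Suc k" for k
    using cInf_lessD[OF ne, of "?\<delta> + 1 / Suc k"] by auto
  then obtain f where fM: "\<And>k. f k \<in> M" and f: "\<And>k. (norm (x - f k))\<^sup>2 < ?\<delta> + 1 / Suc k"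
    by metis
  have close: "(norm (f k - f l))\<^sup>2 \<le> 4 / Suc N" if "N \<le> k" "N \<le> l" for k l N
  proof -
    have mid: "(1/2) *\<^sub>R (f k + f l) \<in> M"
      unfolding scaleR_conv_scaleC
      by (intro complex_vector.subspace_scale[OF sub] complex_vector.subspace_add[OF sub] fM)
    have "(norm (f k - f l))\<^sup>2 = 2 * (norm (x - f k))\<^sup>2 + 2 * (norm (x - f l))\<^sup>2
        - 4 * (norm (x - (1/2) *\<^sub>R (f k + f l)))\<^sup>2"
      by (simp add: power2_norm_eq_inner inner_diff inner_add inner_commute algebra_simps)
    moreover have "1 / real (Suc k) \<le> 1 / Suc N" "1 / real (Suc l) \<le> 1 / Suc N"
      using that by (auto intro!: divide_left_mono)
    ultimately show ?thesis using f[of k] f[of l] le[OF mid] by linarith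
  qed
  have "Cauchy f"
  proof (rule metric_CauchyI)
    fix e :: real assume "0 < e"
    then obtain N where N: "4 / e\<^sup>2 < real (Suc N)" using reals_Archimedean2 less_trans
      by (metis lessI of_nat_less_iff)
    have "dist (f k) (f l) < e" if "N \<le> k" "N \<le> l" for k l
    proof -
      have "(norm (f k - f l))\<^sup>2 < e\<^sup>2"
        using close[OF that] N \<open>0 < e\<close>
        by (intro le_less_trans[OF close[OF that]])
          (simp add: pos_divide_less_eq mult.commute del: of_nat_Suc)
      then show ?thesis using \<open>0 < e\<close> by (simp add: dist_norm power2_less_imp_less)
    qed
    then show "\<exists>N. \<forall>k\<ge>N. \<forall>l\<ge>N. dist (f k) (f l) < e" by blast
  qed
  then obtain m where lim: "f \<longlonglongrightarrow> m" using Cauchy_convergent convergent_def by blast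
  then have mM: "m \<in> M" using cl fM closed_sequentially by blast
  have min: "(norm (x - m))\<^sup>2 \<le> ?\<delta>"
  proof (rule LIMSEQ_le)
    show "(\<lambda>k. (norm (x - f k))\<^sup>2) \<longlonglongrightarrow> (norm (x - m))\<^sup>2" using lim by (intro tendsto_intros)
    have "(\<lambda>k. ?\<delta> + 1 / Suc k) \<longlonglongrightarrow> ?\<delta> + 0"
      by (intro tendsto_intros LIMSEQ_Suc[OF lim_1_over_n])
    then show "(\<lambda>k. ?\<delta> + 1 / Suc k) \<longlonglongrightarrow> ?\<delta>" by simp
    show "\<exists>N. \<forall>k\<ge>N. (norm (x - f k))\<^sup>2 \<le> ?\<delta> + 1 / Suc k" using f less_imp_le by blast
  qed
  define y where "y = x - m"
  have real: "inner s y = 0" if s: "s \<in> M" for s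
  proof (cases "s = 0")
    case False
    define r where "r = inner s y / inner s s"
    have "m + r *\<^sub>R s \<in> M"
      unfolding scaleR_conv_scaleC
      by (intro complex_vector.subspace_add[OF sub] complex_vector.subspace_scale[OF sub] mM s)
    then have "(norm y)\<^sup>2 \<le> (norm (y - r *\<^sub>R s))\<^sup>2"
      using order_trans[OF min le] by (simp only: y_def diff_diff_eq)
    also have "\<dots> = (norm y)\<^sup>2 - 2 * r * inner s y + r * (r * inner s s)"
      by (simp add: power2_norm_eq_inner inner_diff inner_commute)
    also have "\<dots> = (norm y)\<^sup>2 - (inner s y)\<^sup>2 / inner s s"
      using False by (simp add: r_def power2_eq_square)
    finally have "(inner s y)\<^sup>2 / inner s s \<le> 0" by simp
    moreover have "0 < inner s s" using False by simp
    ultimately have "(inner s y)\<^sup>2 \<le> 0" by (simp only: divide_le_0_iff) auto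
    then show ?thesis by simp
  qed simp
  \<comment> \<open>Real orthogonality to both \<open>s\<close> and \<open>\<i> s\<close> is complex orthogonality to \<open>s\<close>.\<close>
  have "cinner s y = 0" if "s \<in> M" for s
    using real[OF that] real[OF complex_vector.subspace_scale[OF sub that, of \<i>]]
    by (simp add: Re_cinner[symmetric] complex_eq_iff)
  moreover have "y \<noteq> 0" using x mM by (auto simp: y_def)
  ultimately show ?thesis using that by blast
qed

lemma closure_span_eq_UNIV:
  fixes S :: "'a::complex_hilbert_space set"
  assumes "\<And>y. (\<And>x. x \<in> S \<Longrightarrow> cinner x y = 0) \<Longrightarrow> y = 0"
  shows "closure (complex_vector.span S) = UNIV"
proof (rule ccontr)
  assume "closure (complex_vector.span S) \<noteq> UNIV"
  then obtain x where "x \<notin> closure (complex_vector.span S)" by blast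
  then obtain y where y: "y \<noteq> 0" "\<And>m. m \<in> closure (complex_vector.span S) \<Longrightarrow> cinner m y = 0"
    using exists_orthogonal_vector[OF closed_csubspace_closure_span] by metis
  then have "cinner x y = 0" if "x \<in> S" for x
    using that closure_subset complex_vector.span_base by blast
  with assms y show False by blast
qed

text \<open>The graph of the linear map taking each \<open>a p\<close> to \<open>b p\<close>. As a relation it is available before
  it is known that the map is well defined.\<close>

inductive_set gram_graph ::
    "'i set \<Rightarrow> ('i \<Rightarrow> 'a::complex_hilbert_space) \<Rightarrow> ('i \<Rightarrow> 'b::complex_hilbert_space) \<Rightarrow> ('a \<times> 'b) set"
  for I a b where
  zero: "(0, 0) \<in> gram_graph I a b"
| step: "p \<in> I \<Longrightarrow> (x, y) \<in> gram_graph I a b \<Longrightarrow>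
    (c *\<^sub>C a p + x, c *\<^sub>C b p + y) \<in> gram_graph I a b"

lemma gram_graph_add:
  assumes "(x, y) \<in> gram_graph I a b" "(x', y') \<in> gram_graph I a b"
  shows "(x + x', y + y') \<in> gram_graph I a b"
  using assms(1)
proof (induction rule: gram_graph.induct)
  case (step p x y c)
  then show ?case using gram_graph.step[of p I "x + x'" "y + y'" a b c] by (simp add: add.assoc)
qed (use assms(2) in simp)

lemma gram_graph_scale:
  assumes "(x, y) \<in> gram_graph I a b"
  shows "(e *\<^sub>C x, e *\<^sub>C y) \<in> gram_graph I a b"
  using assms
proof (induction rule: gram_graph.induct)
  case (step p x y c)
  then show ?case using gram_graph.step[of p I "e *\<^sub>C x" "e *\<^sub>C y" a b "e * c"]
    by (simp add: scaleC_add_right)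
qed (simp add: gram_graph.zero)

lemma gram_graph_diff:
  assumes "(x, y) \<in> gram_graph I a b" "(x', y') \<in> gram_graph I a b"
  shows "(x - x', y - y') \<in> gram_graph I a b"
  using gram_graph_add[OF assms(1) gram_graph_scale[OF assms(2), of "-1"]] by simp

lemma gram_graph_swap: "(x, y) \<in> gram_graph I a b \<Longrightarrow> (y, x) \<in> gram_graph I b a"
  by (induction rule: gram_graph.induct) (auto intro: gram_graph.intros)

lemma gram_graph_cinner:
  assumes gram: "\<And>p q. p \<in> I \<Longrightarrow> q \<in> I \<Longrightarrow> cinner (a p) (a q) = cinner (b p) (b q)"
    and "(x, y) \<in> gram_graph I a b" "(x', y') \<in> gram_graph I a b"
  shows "cinner x x' = cinner y y'"
proof -
  have 1: "cinner x (a q) = cinner y (b q)" if "q \<in> I" for q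
    using assms(2)
    by (induction rule: gram_graph.induct) (auto simp: cinner_add_left gram that)
  show ?thesis using assms(3)
    by (induction rule: gram_graph.induct) (auto simp: cinner_add_right 1)
qed

lemma gram_graph_span:
  assumes "x \<in> complex_vector.span (a ` I)"
  shows "\<exists>y. (x, y) \<in> gram_graph I a b"
  using assms
proof (induction rule: complex_vector.span_induct_alt)
  case (step c z x)
  then show ?case by (auto intro: gram_graph.step)
qed (auto intro: gram_graph.zero)

text \<open>Equality of the Gram matrices makes the linear map between the spans isometric, so the closure of
  its graph is again a graph, and density makes it total in both directions.\<close>

lemma unitary_of_gram:
  fixes a :: "'i \<Rightarrow> 'a::complex_hilbert_space" and b :: "'i \<Rightarrow> 'b::complex_hilbert_space"
  assumes gram: "\<And>p q. p \<in> I \<Longrightarrow> q \<in> I \<Longrightarrow> cinner (a p) (a q) = cinner (b p) (b q)"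
    and da: "closure (complex_vector.span (a ` I)) = UNIV"
    and db: "closure (complex_vector.span (b ` I)) = UNIV"
  obtains U where "unitary U" "\<And>p. p \<in> I \<Longrightarrow> U (a p) = b p"
proof -
  let ?G = "gram_graph I a b"
  define K where "K x y \<longleftrightarrow> (\<exists>f g. (\<forall>n. (f n, g n) \<in> ?G) \<and> f \<longlonglongrightarrow> x \<and> g \<longlonglongrightarrow> y)" for x y
  have K_cinner: "cinner x x' = cinner y y'" if xy: "K x y" "K x' y'" for x y x' y'
  proof -
    obtain f g f' g' where fg: "\<And>n. (f n, g n) \<in> ?G" "f \<longlonglongrightarrow> x" "g \<longlonglongrightarrow> y"
      "\<And>n. (f' n, g' n) \<in> ?G" "f' \<longlonglongrightarrow> x'" "g' \<longlonglongrightarrow> y'"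
      using xy unfolding K_def by blast
    have "(\<lambda>n. cinner (f n) (f' n)) \<longlonglongrightarrow> cinner x x'" using fg by (intro tendsto_cinner)
    moreover have "cinner (f n) (f' n) = cinner (g n) (g' n)" for n
      using gram_graph_cinner[OF gram fg(1) fg(4)] by blast
    ultimately have "(\<lambda>n. cinner (g n) (g' n)) \<longlonglongrightarrow> cinner x x'" by simp
    moreover have "(\<lambda>n. cinner (g n) (g' n)) \<longlonglongrightarrow> cinner y y'" using fg by (intro tendsto_cinner)
    ultimately show ?thesis using LIMSEQ_unique by blast
  qed
  have K_add: "K (x + x') (y + y')" if xy: "K x y" "K x' y'" for x y x' y'
  proof -
    obtain f g f' g' where fg: "\<And>n. (f n, g n) \<in> ?G" "f \<longlonglongrightarrow> x" "g \<longlonglongrightarrow> y"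
      "\<And>n. (f' n, g' n) \<in> ?G" "f' \<longlonglongrightarrow> x'" "g' \<longlonglongrightarrow> y'"
      using xy unfolding K_def by blast
    then show ?thesis unfolding K_def
      by (intro exI[of _ "\<lambda>n. f n + f' n"] exI[of _ "\<lambda>n. g n + g' n"])
        (auto intro: gram_graph_add tendsto_add)
  qed
  have K_scale: "K (c *\<^sub>C x) (c *\<^sub>C y)" if xy: "K x y" for x y c
  proof -
    obtain f g where fg: "\<And>n. (f n, g n) \<in> ?G" "f \<longlonglongrightarrow> x" "g \<longlonglongrightarrow> y"
      using xy unfolding K_def by blast
    then show ?thesis unfolding K_def
      by (intro exI[of _ "\<lambda>n. c *\<^sub>C f n"] exI[of _ "\<lambda>n. c *\<^sub>C g n"])
        (auto intro: gram_graph_scale tendsto_scaleC)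
  qed
  have K_unique: "y = y'" if xy: "K x y" "K x y'" for x y y'
  proof -
    have "K (x + (-1) *\<^sub>C x) (y + (-1) *\<^sub>C y')" by (intro K_add K_scale xy)
    then have "K 0 (y - y')" by simp
    from K_cinner[OF this this] have "cinner (y - y') (y - y') = 0"
      by (metis cinner_linear_simps(1))
    then show ?thesis by simp
  qed
  have isometric: "dist (f m) (f n) = dist (g m) (g n)" if "\<And>n. (f n, g n) \<in> ?G" for f g m n
  proof -
    have "(f m - f n, g m - g n) \<in> ?G" using that by (intro gram_graph_diff)
    from gram_graph_cinner[OF gram this this] show ?thesis
      by (simp add: cinner_self dist_norm power2_eq_iff_nonneg del: of_real_power)
  qed
  have total: "\<exists>y. K x y" for x
  proof -
    have "x \<in> closure (complex_vector.span (a ` I))" using da by simp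
    then obtain f where f: "\<And>n. f n \<in> complex_vector.span (a ` I)" "f \<longlonglongrightarrow> x"
      by (auto simp: closure_sequential)
    have "\<forall>n. \<exists>y. (f n, y) \<in> ?G" using gram_graph_span f by blast
    then obtain g where fg: "\<And>n. (f n, g n) \<in> ?G" by metis
    have "Cauchy g"
      using LIMSEQ_imp_Cauchy[OF f(2)] isometric[of f g, OF fg] by (simp add: Cauchy_def)
    then obtain y where "g \<longlonglongrightarrow> y" using Cauchy_convergent convergent_def by blast
    then show ?thesis using f fg unfolding K_def by blast
  qed
  have onto: "\<exists>x. K x y" for y
  proof -
    have "y \<in> closure (complex_vector.span (b ` I))" using db by simp
    then obtain g where g: "\<And>n. g n \<in> complex_vector.span (b ` I)" "g \<longlonglongrightarrow> y"
      by (auto simp: closure_sequential)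
    have "\<forall>n. \<exists>x. (g n, x) \<in> gram_graph I b a" using gram_graph_span g by blast
    then obtain f where "\<And>n. (g n, f n) \<in> gram_graph I b a" by metis
    then have fg: "\<And>n. (f n, g n) \<in> ?G" by (rule gram_graph_swap)
    have "Cauchy f"
      using LIMSEQ_imp_Cauchy[OF g(2)] isometric[of f g, OF fg] by (simp add: Cauchy_def)
    then obtain x where "f \<longlonglongrightarrow> x" using Cauchy_convergent convergent_def by blast
    then show ?thesis using g fg unfolding K_def by blast
  qed
  obtain U where U: "\<And>x. K x (U x)" using total by metis
  have iso: "cinner (U x) (U y) = cinner x y" for x y using K_cinner[OF U U] by simp
  have "norm (U x) = norm x" for x
    using iso[of x x] by (simp add: cinner_self power2_eq_iff_nonneg del: of_real_power)
  then have "bounded_clinear U"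
    unfolding bounded_operator_def
    using K_unique[OF U K_add[OF U U]] K_unique[OF U K_scale[OF U]]
    by (auto intro!: exI[of _ 1])
  moreover have "surj U" using onto K_unique U by (metis surjI)
  moreover have "U (a p) = b p" if "p \<in> I" for p
  proof -
    have "(a p, b p) \<in> ?G"
      using gram_graph.step[OF that gram_graph.zero, where c = 1 and a = a and b = b] by simp
    then have "K (a p) (b p)" unfolding K_def by (intro exI[of _ "\<lambda>n. a p"] exI[of _ "\<lambda>n. b p"]) simp
    then show ?thesis using K_unique U by blast
  qed
  ultimately show ?thesis using that iso unfolding unitary_def by blast
qed

section \<open>Hilbert space valued holomorphic functions\<close>

lemma vector_holomorphic_onE:
  assumes "vector_holomorphic_on \<gamma> \<Omega>" "open \<Omega>"
  obtains d where "\<And>w. w \<in> \<Omega> \<Longrightarrow> (\<gamma> has_derivative (\<lambda>h. h *\<^sub>C d w)) (at w)"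
  using assms at_within_open unfolding vector_holomorphic_on_def by metis

lemma vector_holomorphic_onI:
  assumes "\<And>w. w \<in> \<Omega> \<Longrightarrow> (\<gamma> has_derivative (\<lambda>h. h *\<^sub>C d w)) (at w)"
  shows "vector_holomorphic_on \<gamma> \<Omega>"
  unfolding vector_holomorphic_on_def using has_derivative_at_withinI[OF assms] by blast

lemma has_field_derivative_cinner:
  assumes "(\<gamma> has_derivative (\<lambda>h. h *\<^sub>C d)) (at w)"
  shows "((\<lambda>z. cinner (\<gamma> z) x) has_field_derivative cinner d x) (at w)"
proof -
  have "((\<lambda>z. cinner (\<gamma> z) x) has_derivative (\<lambda>h. cinner (\<gamma> w) 0 + cinner (h *\<^sub>C d) x)) (at w)"
    by (rule has_derivative_cinner[OF assms has_derivative_const])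
  moreover have "(\<lambda>h. cinner (\<gamma> w) 0 + cinner (h *\<^sub>C d) x) = (*) (cinner d x)"
    by (auto simp: fun_eq_iff)
  ultimately show ?thesis by (simp add: has_field_derivative_def)
qed

lemma holomorphic_cinner:
  assumes "vector_holomorphic_on \<gamma> \<Omega>" "open \<Omega>"
  shows "(\<lambda>z. cinner (\<gamma> z) x) holomorphic_on \<Omega>"
proof -
  obtain d where "\<And>w. w \<in> \<Omega> \<Longrightarrow> (\<gamma> has_derivative (\<lambda>h. h *\<^sub>C d w)) (at w)"
    using vector_holomorphic_onE[OF assms] by blast
  then have "\<And>w. w \<in> \<Omega> \<Longrightarrow> ((\<lambda>z. cinner (\<gamma> z) x) has_field_derivative cinner (d w) x) (at w)"
    by (rule has_field_derivative_cinner)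
  then show ?thesis using assms(2) by (auto simp: holomorphic_on_open)
qed

lemma vector_holomorphic_subset:
  "vector_holomorphic_on \<gamma> \<Omega> \<Longrightarrow> D \<subseteq> \<Omega> \<Longrightarrow> vector_holomorphic_on \<gamma> D"
  unfolding vector_holomorphic_on_def by (meson has_derivative_subset subsetD)

lemma vector_holomorphic_scaleC:
  assumes "f holomorphic_on \<Omega>" "vector_holomorphic_on \<gamma> \<Omega>"
  shows "vector_holomorphic_on (\<lambda>w. f w *\<^sub>C \<gamma> w) \<Omega>"
  unfolding vector_holomorphic_on_def
proof
  fix w assume w: "w \<in> \<Omega>"
  obtain f' where "(f has_field_derivative f') (at w within \<Omega>)"
    using assms(1) w by (auto simp: holomorphic_on_def field_differentiable_def)
  then have f: "(f has_derivative (\<lambda>h. f' * h)) (at w within \<Omega>)"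
    by (simp add: has_field_derivative_def)
  obtain d where g: "(\<gamma> has_derivative (\<lambda>h. h *\<^sub>C d)) (at w within \<Omega>)"
    using assms(2) w by (auto simp: vector_holomorphic_on_def)
  have "(\<lambda>h. f w *\<^sub>C (h *\<^sub>C d) + (f' * h) *\<^sub>C \<gamma> w) = (\<lambda>h. h *\<^sub>C (f w *\<^sub>C d + f' *\<^sub>C \<gamma> w))"
    by (auto simp: fun_eq_iff scaleC_add_right mult.commute)
  then show "\<exists>d. ((\<lambda>w. f w *\<^sub>C \<gamma> w) has_derivative (\<lambda>h. h *\<^sub>C d)) (at w within \<Omega>)"
    using has_derivative_scaleC[OF f g] by auto
qed

lemma vector_holomorphic_bounded_clinear:
  assumes "bounded_clinear U" "vector_holomorphic_on \<gamma> \<Omega>"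
  shows "vector_holomorphic_on (\<lambda>w. U (\<gamma> w)) \<Omega>"
  unfolding vector_holomorphic_on_def
proof
  fix w assume "w \<in> \<Omega>"
  then obtain d where "(\<gamma> has_derivative (\<lambda>h. h *\<^sub>C d)) (at w within \<Omega>)"
    using assms(2) by (auto simp: vector_holomorphic_on_def)
  from bounded_linear.has_derivative[OF bounded_clinear_linear[OF assms(1)] this]
  show "\<exists>d. ((\<lambda>w. U (\<gamma> w)) has_derivative (\<lambda>h. h *\<^sub>C d)) (at w within \<Omega>)"
    using assms(1) by (auto simp: bounded_clinear_scaleC)
qed

text \<open>Cauchy's inequality bounds the third derivative. The point is that the constant depends only on
  the bound for \<open>f\<close>: this uniformity allows passing from scalar to vector-valued functions.\<close>

lemma holomorphic_deriv_taylor: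
  fixes f :: "complex \<Rightarrow> complex"
  assumes holo: "f holomorphic_on S" and S: "open S" "cball w (2 * r) \<subseteq> S" and r: "0 < r"
    and bound: "\<And>z. z \<in> cball w (2 * r) \<Longrightarrow> cmod (f z) \<le> B" and z: "z \<in> cball w r"
  shows "cmod (deriv f z - deriv f w - deriv (deriv f) w * (z - w)) \<le> 6 * B / r ^ 3 * (cmod (z - w))\<^sup>2"
proof -
  have sub: "cball u r \<subseteq> cball w (2 * r)" if "u \<in> cball w r" for u
  proof
    fix v assume "v \<in> cball u r"
    then show "v \<in> cball w (2 * r)" using that dist_triangle[of w v u] by simp
  qed
  have third: "cmod ((deriv ^^ 3) f u) \<le> 6 * B / r ^ 3" if u: "u \<in> cball w r" for u
  proof -
    have "f holomorphic_on cball u r" using holo sub[OF u] S(2) holomorphic_on_subset by blast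
    then have "cmod ((deriv ^^ 3) f u) \<le> fact 3 * B / r ^ 3"
      using r bound sub[OF u]
      by (intro Cauchy_inequality)
        (auto intro: holomorphic_on_subset holomorphic_on_imp_continuous_on simp: dist_norm subset_iff)
    then show ?thesis by (simp add: fact_numeral)
  qed
  let ?F = "\<lambda>i. (deriv ^^ Suc i) f"
  have "cmod (?F 0 z - (\<Sum>i\<le>1. ?F i w * (z - w) ^ i / fact i)) \<le> (6 * B / r ^ 3) * cmod (z - w) ^ Suc 1 / fact 1"
  proof (rule complex_Taylor[where S = "cball w r"])
    fix i x assume x: "x \<in> cball w r"
    then have "x \<in> S" using S(2) r by (auto simp: subset_iff)
    then show "(?F i has_field_derivative ?F (Suc i) x) (at x within cball w r)"
      using has_field_derivative_higher_deriv[OF holo S(1), of x "Suc i"] has_field_derivative_at_within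
      by blast
  next
    fix x assume "x \<in> cball w r"
    then show "cmod (?F (Suc 1) x) \<le> 6 * B / r ^ 3" using third by (simp add: numeral_3_eq_3)
  qed (use z r in auto)
  then show ?thesis by (simp add: power2_eq_square diff_diff_eq mult.assoc)
qed

text \<open>Testing the preceding estimate against all vectors shows that the difference quotients of the
  derivative form a Cauchy net in norm; completeness provides their limit.\<close>

lemma vector_derivative_holomorphic:
  assumes \<Omega>: "open \<Omega>"
    and d: "\<And>w. w \<in> \<Omega> \<Longrightarrow> (\<gamma> has_derivative (\<lambda>h. h *\<^sub>C d w)) (at w)"
  shows "vector_holomorphic_on d \<Omega>"
  unfolding vector_holomorphic_on_def
proof
  fix w assume w: "w \<in> \<Omega>"
  obtain R where R: "0 < R" "cball w R \<subseteq> \<Omega>" using \<Omega> w open_contains_cball by blast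
  define r where "r = R / 2"
  have r: "0 < r" "cball w (2 * r) \<subseteq> \<Omega>" using R by (auto simp: r_def)
  have "continuous (at z) \<gamma>" if "z \<in> cball w (2 * r)" for z
    using has_derivative_continuous[OF d] that r(2) by blast
  then have cont: "continuous_on (cball w (2 * r)) \<gamma>"
    by (intro continuous_at_imp_continuous_on) blast
  have "compact (\<gamma> ` cball w (2 * r))" by (intro compact_continuous_image cont compact_cball)
  then obtain M where M: "\<And>z. z \<in> cball w (2 * r) \<Longrightarrow> norm (\<gamma> z) \<le> M"
    using compact_imp_bounded[of "\<gamma> ` cball w (2 * r)"] unfolding bounded_iff by blast
  define C where "C = 6 * M / r ^ 3"
  have "0 \<le> M" using r by (intro order_trans[OF norm_ge_zero M[of w]]) simp
  then have C: "0 \<le> C" using r by (simp add: C_def)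
  define q where "q z = inverse (z - w) *\<^sub>C (d z - d w)" for z
  have est: "norm (q z - q u) \<le> C * (cmod (z - w) + cmod (u - w))"
    if z: "z \<in> cball w r - {w}" and u: "u \<in> cball w r - {w}" for z u
  proof -
    define x where "x = q z - q u"
    define f where "f v = cinner (\<gamma> v) x" for v
    have holo: "f holomorphic_on \<Omega>"
      unfolding f_def by (rule holomorphic_cinner[OF vector_holomorphic_onI[OF d] \<Omega>])
    have der: "deriv f v = cinner (d v) x" if "v \<in> \<Omega>" for v
      unfolding f_def by (rule DERIV_imp_deriv[OF has_field_derivative_cinner[OF d[OF that]]])
    have quot: "cmod (cinner (q v) x - deriv (deriv f) w) \<le> C * norm x * cmod (v - w)"
      if v: "v \<in> cball w r - {w}" for v
    proof -
      have ne: "v - w \<noteq> 0" using v by simp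
      have "cmod (f s) \<le> M * norm x" if "s \<in> cball w (2 * r)" for s
        unfolding f_def using norm_cinner_le[of "\<gamma> s" x] mult_right_mono[OF M[OF that], of "norm x"] by simp
      then have "cmod (deriv f v - deriv f w - deriv (deriv f) w * (v - w))
          \<le> 6 * (M * norm x) / r ^ 3 * (cmod (v - w))\<^sup>2"
        using holomorphic_deriv_taylor[OF holo \<Omega> r(2,1), of "M * norm x" v] v by blast
      moreover have "v \<in> \<Omega>" using v r by (auto simp: subset_iff)
      ultimately have "cmod (cinner (d v - d w) x - deriv (deriv f) w * (v - w))
          \<le> C * norm x * cmod (v - w) * cmod (v - w)"
        using w by (simp add: der cinner_diff_left C_def power2_eq_square mult_ac)
      moreover have "cinner (q v) x - deriv (deriv f) w
          = (cinner (d v - d w) x - deriv (deriv f) w * (v - w)) / (v - w)"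
        using ne by (simp add: q_def divide_simps)
      ultimately show ?thesis using ne by (simp add: norm_divide pos_divide_le_eq)
    qed
    have "norm x * norm x = cmod (cinner (q z) x - cinner (q u) x)"
      by (simp add: cinner_diff_left[symmetric] x_def[symmetric] cinner_self power2_eq_square norm_mult)
    also have "\<dots> \<le> C * norm x * cmod (z - w) + C * norm x * cmod (u - w)"
      using quot[OF z] quot[OF u]
        norm_triangle_ineq4[of "cinner (q z) x - deriv (deriv f) w" "cinner (q u) x - deriv (deriv f) w"]
      by simp
    also have "\<dots> = C * (cmod (z - w) + cmod (u - w)) * norm x" by (simp add: algebra_simps)
    finally have "norm x \<le> C * (cmod (z - w) + cmod (u - w)) \<or> norm x = 0"
      using mult_right_le_imp_le[of "norm x" "norm x" "C * (cmod (z - w) + cmod (u - w))"] by auto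
    then show ?thesis using C by (auto simp: x_def)
  qed
  \<comment> \<open>Any sequence tending to \<open>w\<close> yields the limit of the quotients; the estimate then gives the
    rate of convergence.\<close>
  define s where "s k = w + of_real (r / Suc k)" for k
  have s_norm: "cmod (s k - w) = r / Suc k" for k
    using r unfolding s_def add_diff_cancel_left' norm_of_real by simp
  have s: "s k \<in> cball w r - {w}" for k
  proof -
    have "0 < r / Suc k" "r / Suc k \<le> r" using r by (auto simp: divide_le_eq distrib_left)
    then show ?thesis using s_norm[of k] by (auto simp: dist_norm norm_minus_commute)
  qed
  have s_lim: "(\<lambda>k. cmod (s k - w)) \<longlonglongrightarrow> 0"
  proof -
    have "(\<lambda>k. r * (1 / real (Suc k))) \<longlonglongrightarrow> r * 0"
      by (intro tendsto_intros LIMSEQ_Suc[OF lim_1_over_n])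
    then show ?thesis by (simp add: s_norm)
  qed
  have "Cauchy (\<lambda>k. q (s k))"
  proof (rule metric_CauchyI)
    fix e :: real assume e: "0 < e"
    have "(\<lambda>k. C * cmod (s k - w)) \<longlonglongrightarrow> C * 0" by (intro tendsto_intros s_lim)
    then have "\<forall>\<^sub>F k in sequentially. C * cmod (s k - w) < e / 2"
      using e by (intro order_tendstoD(2)) auto
    then obtain N where N: "\<And>k. N \<le> k \<Longrightarrow> C * cmod (s k - w) < e / 2"
      by (auto simp: eventually_sequentially)
    then have "dist (q (s k)) (q (s l)) < e" if "N \<le> k" "N \<le> l" for k l
    proof -
      have "C * cmod (s k - w) + C * cmod (s l - w) < e"
        using N[OF that(1)] N[OF that(2)] by linarith
      then show ?thesis using est[OF s s, of k l] by (simp add: dist_norm distrib_left)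
    qed
    then show "\<exists>N. \<forall>k\<ge>N. \<forall>l\<ge>N. dist (q (s k)) (q (s l)) < e" by blast
  qed
  then obtain e where e: "(\<lambda>k. q (s k)) \<longlonglongrightarrow> e" using Cauchy_convergent convergent_def by blast
  have rate: "norm (q z - e) \<le> C * cmod (z - w)" if z: "z \<in> cball w r - {w}" for z
  proof (rule LIMSEQ_le)
    show "(\<lambda>k. norm (q z - q (s k))) \<longlonglongrightarrow> norm (q z - e)" by (intro tendsto_intros e)
    have "(\<lambda>k. C * (cmod (z - w) + cmod (s k - w))) \<longlonglongrightarrow> C * (cmod (z - w) + 0)"
      by (intro tendsto_intros s_lim)
    then show "(\<lambda>k. C * (cmod (z - w) + cmod (s k - w))) \<longlonglongrightarrow> C * cmod (z - w)" by simp
    show "\<exists>N. \<forall>k\<ge>N. norm (q z - q (s k)) \<le> C * (cmod (z - w) + cmod (s k - w))"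
      using est[OF z s] by blast
  qed
  have "(d has_derivative (\<lambda>h. h *\<^sub>C e)) (at w)"
    unfolding has_derivative_iff_norm
  proof
    show "bounded_linear (\<lambda>h. h *\<^sub>C e)"
      by (rule bounded_bilinear.bounded_linear_left[OF bounded_bilinear_scaleC])
    have bound: "norm (d z - d w - (z - w) *\<^sub>C e) / norm (z - w) \<le> C * cmod (z - w)"
      if z: "z \<in> cball w r - {w}" for z
    proof -
      have "d z - d w - (z - w) *\<^sub>C e = (z - w) *\<^sub>C (q z - e)"
        using z by (simp add: q_def complex_vector.scale_right_diff_distrib)
      then show ?thesis using rate[OF z] z by simp
    qed
    have "((\<lambda>z. C * cmod (z - w)) \<longlongrightarrow> C * cmod (w - w)) (at w)" by (intro tendsto_intros)
    then have lim: "((\<lambda>z. C * cmod (z - w)) \<longlongrightarrow> 0) (at w)" by simp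
    have "\<forall>\<^sub>F z in at w. z \<in> ball w r - {w}"
      using eventually_at_in_open[of "ball w r" w] r by auto
    then have "\<forall>\<^sub>F z in at w. norm (d z - d w - (z - w) *\<^sub>C e) / norm (z - w) \<le> C * cmod (z - w)"
      by eventually_elim (rule bound, auto)
    then show "((\<lambda>z. norm (d z - d w - (z - w) *\<^sub>C e) / norm (z - w)) \<longlongrightarrow> 0) (at w)"
      by (intro tendsto_sandwich[OF _ _ tendsto_const lim]) auto
  qed
  then show "\<exists>e. (d has_derivative (\<lambda>h. h *\<^sub>C e)) (at w within \<Omega>)"
    using has_derivative_at_withinI by blast
qed

text \<open>Where two sections of a line bundle are proportional, the factor is locally a quotient of
  scalar holomorphic functions, and is therefore holomorphic.\<close>

lemma proportional_sections:
  assumes \<Omega>: "open \<Omega>" and \<gamma>: "vector_holomorphic_on \<gamma> \<Omega>" and \<delta>: "vector_holomorphic_on \<delta> \<Omega>"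
    and line: "\<And>w. w \<in> \<Omega> \<Longrightarrow> \<exists>c. \<gamma> w = c *\<^sub>C \<delta> w" and nz: "\<And>w. w \<in> \<Omega> \<Longrightarrow> \<delta> w \<noteq> 0"
  obtains f where "f holomorphic_on \<Omega>" "\<And>w. w \<in> \<Omega> \<Longrightarrow> \<gamma> w = f w *\<^sub>C \<delta> w"
proof -
  obtain f where f: "\<And>w. w \<in> \<Omega> \<Longrightarrow> \<gamma> w = f w *\<^sub>C \<delta> w" using line by metis
  have "f field_differentiable at v" if v: "v \<in> \<Omega>" for v
  proof -
    let ?n = "\<lambda>w. cinner (\<gamma> w) (\<delta> v)" and ?m = "\<lambda>w. cinner (\<delta> w) (\<delta> v)"
    define S where "S = \<Omega> \<inter> ?m -` (- {0})"
    have hol: "?n holomorphic_on \<Omega>" "?m holomorphic_on \<Omega>"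
      using \<gamma> \<delta> \<Omega> by (auto intro: holomorphic_cinner)
    have S: "open S" unfolding S_def
      using holomorphic_on_imp_continuous_on[OF hol(2)] \<Omega>
      by (intro continuous_open_preimage) auto
    have "v \<in> S" using v nz[OF v] by (simp add: S_def)
    have "(\<lambda>w. ?n w / ?m w) holomorphic_on S"
      by (intro holomorphic_on_divide holomorphic_on_subset[OF hol(1)] holomorphic_on_subset[OF hol(2)])
        (auto simp: S_def)
    moreover have "?n w / ?m w = f w" if "w \<in> S" for w
      using that f[of w] by (auto simp: S_def)
    ultimately have "f holomorphic_on S" by (rule holomorphic_transform)
    then show ?thesis using S \<open>v \<in> S\<close> holomorphic_on_imp_differentiable_at by blast
  qed
  then have "f holomorphic_on \<Omega>"
    by (auto simp: holomorphic_on_def intro: field_differentiable_at_within)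
  then show ?thesis using that f by blast
qed

section \<open>Polarisation\<close>

lemma holomorphic_eq_0_if_real_eq_0:
  assumes f: "f holomorphic_on S" and S: "open S" "connected S" "0 \<in> S"
    and real: "\<And>x. complex_of_real x \<in> S \<Longrightarrow> f (of_real x) = 0" and z: "z \<in> S"
  shows "f z = 0"
proof (rule analytic_continuation[OF f S(1,2) _ S(3)])
  show "S \<inter> range of_real \<subseteq> S" by simp
  show "0 islimpt (S \<inter> range complex_of_real)"
    unfolding islimpt_def
  proof (intro allI impI)
    fix U :: "complex set" assume "0 \<in> U" "open U"
    then have "open (S \<inter> U)" "0 \<in> S \<inter> U" using S by auto
    then obtain e where e: "0 < e" "ball 0 e \<subseteq> S \<inter> U" using open_contains_ball by blast
    then have "complex_of_real (e / 2) \<in> S \<inter> U" by (auto simp: subset_iff)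
    moreover have "complex_of_real (e / 2) \<noteq> 0" using e by (simp only: of_real_eq_0_iff)
    ultimately show "\<exists>y\<in>S \<inter> range complex_of_real. y \<in> U \<and> y \<noteq> 0" by blast
  qed
qed (use real z in auto)

lemma field_differentiable_sesquilinear:
  fixes a b :: "complex \<Rightarrow> 'a::complex_hilbert_space"
  assumes "(f has_field_derivative f') (at s)" "(g has_field_derivative g') (at s)"
    and "(a has_derivative (\<lambda>h. h *\<^sub>C p)) (at (f s))"
    and "(b has_derivative (\<lambda>h. h *\<^sub>C q)) (at (cnj (g s)))"
  shows "(\<lambda>s. cinner (a (f s)) (b (cnj (g s)))) field_differentiable (at s)"
proof -
  have 1: "((\<lambda>s. a (f s)) has_derivative (\<lambda>h. (f' * h) *\<^sub>C p)) (at s)"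
    using has_derivative_compose[OF assms(1)[unfolded has_field_derivative_def] assms(3)] .
  have "((\<lambda>s. cnj (g s)) has_derivative (\<lambda>h. cnj (g' * h))) (at s)"
    by (rule has_derivative_cnj[OF assms(2)[unfolded has_field_derivative_def]])
  from has_derivative_compose[OF this assms(4)]
  have 2: "((\<lambda>s. b (cnj (g s))) has_derivative (\<lambda>h. cnj (g' * h) *\<^sub>C q)) (at s)" .
  have "(\<lambda>h. cinner (a (f s)) (cnj (g' * h) *\<^sub>C q) + cinner ((f' * h) *\<^sub>C p) (b (cnj (g s))))
      = (*) (g' * cinner (a (f s)) q + f' * cinner p (b (cnj (g s))))"
    by (auto simp: fun_eq_iff algebra_simps)
  then show ?thesis
    using has_derivative_cinner[OF 1 2]
    by (auto simp: field_differentiable_def has_field_derivative_def)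
qed

text \<open>The kernel \<open>\<langle>a w, a z\<rangle> - \<langle>b w, b z\<rangle>\<close> is holomorphic in \<open>w\<close> and antiholomorphic in \<open>z\<close>. In the
  coordinates \<open>w - c = s + \<i> t\<close> and \<open>(z - c)\<^bold>* = s - \<i> t\<close>, with \<open>s\<close> and \<open>t\<close> complex, it is holomorphic in each
  variable, and the diagonal \<open>w = z\<close> is the set of real \<open>s\<close> and \<open>t\<close>. Two applications of the identity
  theorem in one variable therefore recover the kernel from the diagonal.\<close>

lemma cinner_eq_of_norm_eq:
  fixes a :: "complex \<Rightarrow> 'a::complex_hilbert_space" and b :: "complex \<Rightarrow> 'b::complex_hilbert_space"
  assumes a: "vector_holomorphic_on a (ball c r)" and b: "vector_holomorphic_on b (ball c r)"
    and eq: "\<And>w. w \<in> ball c r \<Longrightarrow> norm (a w) = norm (b w)"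
    and w: "w \<in> ball c r" and z: "z \<in> ball c r"
  shows "cinner (a w) (a z) = cinner (b w) (b z)"
proof -
  let ?B = "ball c r"
  obtain da where da: "\<And>w. w \<in> ?B \<Longrightarrow> (a has_derivative (\<lambda>h. h *\<^sub>C da w)) (at w)"
    using vector_holomorphic_onE[OF a open_ball] by blast
  obtain db where db: "\<And>w. w \<in> ?B \<Longrightarrow> (b has_derivative (\<lambda>h. h *\<^sub>C db w)) (at w)"
    using vector_holomorphic_onE[OF b open_ball] by blast
  define F where "F w z = cinner (a w) (a z) - cinner (b w) (b z)" for w z
  define h where "h s t = F (c + (s + \<i> * t)) (cnj (cnj c + (s - \<i> * t)))" for s t
  define A where "A s t \<longleftrightarrow> cmod (s + \<i> * t) < r \<and> cmod (s - \<i> * t) < r" for s t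
  have dom: "c + (s + \<i> * t) \<in> ?B" "cnj (cnj c + (s - \<i> * t)) \<in> ?B" if "A s t" for s t
  proof -
    have "c + (s + \<i> * t) - c = s + \<i> * t" by simp
    then show "c + (s + \<i> * t) \<in> ?B"
      using that by (simp only: A_def mem_ball dist_norm norm_minus_commute[of c])
    have "cnj (cnj c + (s - \<i> * t)) - c = cnj (s - \<i> * t)" by simp
    then show "cnj (cnj c + (s - \<i> * t)) \<in> ?B"
      using that by (simp only: A_def mem_ball dist_norm norm_minus_commute[of c] complex_mod_cnj)
  qed
  have diff: "(\<lambda>x. F (c + f x) (cnj (cnj c + g x))) field_differentiable at x"
    if "(f has_field_derivative f') (at x)" "(g has_field_derivative g') (at x)"
      "c + f x \<in> ?B" "cnj (cnj c + g x) \<in> ?B" for f g f' g' x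
  proof -
    have "((\<lambda>x. c + f x) has_field_derivative f') (at x)" "((\<lambda>x. cnj c + g x) has_field_derivative g') (at x)"
      using that by (auto intro!: derivative_eq_intros)
    then show ?thesis
      unfolding F_def using that da db
      by (intro field_differentiable_diff field_differentiable_sesquilinear) blast+
  qed
  have open_conv: "open {s. cmod (s + x) < r \<and> cmod (s - x) < r}"
    "convex {s. cmod (s + x) < r \<and> cmod (s - x) < r}" for x
  proof -
    have "{s. cmod (s + x) < r \<and> cmod (s - x) < r} = ball (- x) r \<inter> ball x r"
      by (auto simp: dist_norm norm_minus_commute add.commute)
    then show "open {s. cmod (s + x) < r \<and> cmod (s - x) < r}"
      "convex {s. cmod (s + x) < r \<and> cmod (s - x) < r}" by (auto intro: convex_Int)
  qed
  have real: "h (of_real s) (of_real t) = 0" if "A (of_real s) (of_real t)" for s t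
  proof -
    have eqv: "cnj (cnj c + (of_real s - \<i> * of_real t)) = c + (of_real s + \<i> * of_real t)" by simp
    show ?thesis using dom(1)[OF that] eq unfolding h_def F_def eqv by (simp add: cinner_self)
  qed
  have half: "h s (of_real t) = 0" if A: "A s (of_real t)" for s t
  proof (rule holomorphic_eq_0_if_real_eq_0[where f = "\<lambda>s. h s (of_real t)" and S = "{s. A s (of_real t)}"])
    show "open {s. A s (of_real t)}" "connected {s. A s (of_real t)}"
      using open_conv[of "\<i> * of_real t"] convex_connected by (auto simp: A_def)
    show "(\<lambda>s. h s (of_real t)) holomorphic_on {s. A s (of_real t)}"
    proof (rule holomorphic_onI, rule field_differentiable_at_within)
      fix s assume "s \<in> {s. A s (of_real t)}"
      then have "A s (of_real t)" by simp
      then show "(\<lambda>s. h s (of_real t)) field_differentiable at s"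
        unfolding h_def by (intro diff[where f' = 1 and g' = 1] dom) (auto intro!: derivative_eq_intros)
    qed
    have "2 * cmod (of_real t) = cmod ((s + \<i> * of_real t) - (s - \<i> * of_real t))"
      by (simp add: norm_mult)
    also have "\<dots> < r + r"
      using A norm_triangle_ineq4[of "s + \<i> * of_real t" "s - \<i> * of_real t"] by (simp add: A_def)
    finally show "0 \<in> {s. A s (of_real t)}" by (simp add: A_def norm_mult)
  qed (use real A in auto)
  have full: "h s t = 0" if A: "A s t" for s t
  proof (rule holomorphic_eq_0_if_real_eq_0[where f = "h s" and S = "{t. A s t}"])
    have "cmod (s + \<i> * t) = cmod (t + - \<i> * s)" "cmod (s - \<i> * t) = cmod (t - - \<i> * s)" for t
    proof -
      have "cmod (s + \<i> * t) = cmod (\<i> * (t + - \<i> * s))" "cmod (s - \<i> * t) = cmod (- \<i> * (t - - \<i> * s))"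
        by (simp_all add: algebra_simps)
      then show "cmod (s + \<i> * t) = cmod (t + - \<i> * s)" "cmod (s - \<i> * t) = cmod (t - - \<i> * s)"
        by (simp_all only: norm_mult norm_minus_cancel norm_ii mult_1)
    qed
    then show "open {t. A s t}" "connected {t. A s t}"
      using open_conv[of "- \<i> * s"] convex_connected by (auto simp: A_def)
    show "h s holomorphic_on {t. A s t}"
    proof (rule holomorphic_onI, rule field_differentiable_at_within)
      fix t assume "t \<in> {t. A s t}"
      then have "A s t" by simp
      then show "h s field_differentiable at t"
        unfolding h_def by (intro diff[where f' = \<i> and g' = "- \<i>"] dom) (auto intro!: derivative_eq_intros)
    qed
    have "2 * cmod s = cmod ((s + \<i> * t) + (s - \<i> * t))" by (simp add: norm_mult flip: mult_2)
    also have "\<dots> < r + r"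
      using A norm_triangle_ineq[of "s + \<i> * t" "s - \<i> * t"] unfolding A_def by linarith
    finally show "0 \<in> {t. A s t}" by (simp add: A_def)
  qed (use half A in auto)
  define u v where "u = w - c" and "v = cnj (z - c)"
  define s t where "s = (u + v) / 2" and "t = (u - v) / (2 * \<i>)"
  have st: "s + \<i> * t = u" "s - \<i> * t = v"
    unfolding s_def t_def by (simp_all add: field_simps)
  have "cmod u < r" "cmod v < r"
    using w z by (simp_all only: u_def v_def mem_ball dist_norm norm_minus_commute complex_mod_cnj)
  then have "A s t" by (simp add: A_def st)
  then have "h s t = 0" by (rule full)
  moreover have "c + (s + \<i> * t) = w" "cnj (cnj c + (s - \<i> * t)) = z"
    unfolding st by (simp_all add: u_def v_def)
  ultimately have "F w z = 0" unfolding h_def by (simp only:)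
  then show ?thesis by (simp add: F_def)
qed

section \<open>Curvature\<close>

text \<open>The derivative of \<open>log |\<gamma>|\<^sup>2\<close> in the direction \<open>h\<close> is \<open>2 Re (h P)\<close> with
  \<open>P = \<langle>d, \<gamma>\<rangle> / |\<gamma>|\<^sup>2\<close> if \<open>d\<close> is the derivative of \<open>\<gamma>\<close>, so that \<open>P\<close> is its Wirtinger derivative.\<close>

definition log_norm_deriv ::
    "(complex \<Rightarrow> 'a::complex_hilbert_space) \<Rightarrow> (complex \<Rightarrow> 'a) \<Rightarrow> complex \<Rightarrow> complex" where
  "log_norm_deriv \<gamma> d w = cinner (d w) (\<gamma> w) / complex_of_real ((norm (\<gamma> w))\<^sup>2)"

lemma has_derivative_log_norm:
  assumes "(\<gamma> has_derivative (\<lambda>h. h *\<^sub>C d w)) (at w)" and nz: "\<gamma> w \<noteq> 0"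
  shows "((\<lambda>z. ln ((norm (\<gamma> z))\<^sup>2)) has_derivative (\<lambda>h. 2 * Re (h * log_norm_deriv \<gamma> d w))) (at w)"
proof -
  have "((\<lambda>z. inner (\<gamma> z) (\<gamma> z)) has_derivative (\<lambda>h. inner (\<gamma> w) (h *\<^sub>C d w) + inner (h *\<^sub>C d w) (\<gamma> w))) (at w)"
    by (rule has_derivative_inner[OF assms(1) assms(1)])
  moreover have "inner (\<gamma> w) (h *\<^sub>C d w) + inner (h *\<^sub>C d w) (\<gamma> w) = 2 * Re (h * cinner (d w) (\<gamma> w))" for h
  proof -
    have "inner (h *\<^sub>C d w) (\<gamma> w) = Re (h * cinner (d w) (\<gamma> w))"
      by (simp only: Re_cinner[symmetric] cinner_scaleC_left)
    then show ?thesis by (simp add: inner_commute[of "\<gamma> w"])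
  qed
  ultimately have N: "((\<lambda>z. (norm (\<gamma> z))\<^sup>2) has_derivative (\<lambda>h. 2 * Re (h * cinner (d w) (\<gamma> w)))) (at w)"
    by (simp add: power2_norm_eq_inner)
  have "0 < (norm (\<gamma> w))\<^sup>2" using nz by simp
  from has_derivative_ln[OF this N]
  have "((\<lambda>z. ln ((norm (\<gamma> z))\<^sup>2)) has_derivative (\<lambda>h. 2 * Re (h * cinner (d w) (\<gamma> w)) * inverse ((norm (\<gamma> w))\<^sup>2))) (at w)"
    by simp
  moreover have "2 * Re (h * cinner (d w) (\<gamma> w)) * inverse ((norm (\<gamma> w))\<^sup>2) = 2 * Re (h * log_norm_deriv \<gamma> d w)" for h
    by (simp add: log_norm_deriv_def divide_inverse flip: of_real_inverse of_real_power mult.assoc)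
  ultimately show ?thesis by simp
qed

lemma wirtinger_of_real:
  assumes "(L has_derivative (\<lambda>h. 2 * Re (h * P))) (at w)"
  shows "wirtinger (\<lambda>z. complex_of_real (L z)) w = P"
proof -
  have "((\<lambda>z. complex_of_real (L z)) has_derivative (\<lambda>h. complex_of_real (2 * Re (h * P)))) (at w)"
    by (rule bounded_linear.has_derivative[OF bounded_linear_of_real assms])
  then have "frechet_derivative (\<lambda>z. complex_of_real (L z)) (at w) = (\<lambda>h. complex_of_real (2 * Re (h * P)))"
    by (metis frechet_derivative_at)
  then show ?thesis by (simp add: wirtinger_def complex_eq_iff)
qed

lemma log_norm_deriv_differentiable:
  assumes \<Omega>: "open \<Omega>" and d: "\<And>w. w \<in> \<Omega> \<Longrightarrow> (\<gamma> has_derivative (\<lambda>h. h *\<^sub>C d w)) (at w)"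
    and nz: "\<And>w. w \<in> \<Omega> \<Longrightarrow> \<gamma> w \<noteq> 0" and w: "w \<in> \<Omega>"
  shows "log_norm_deriv \<gamma> d differentiable (at w)"
proof -
  obtain e where "(d has_derivative (\<lambda>h. h *\<^sub>C e)) (at w)"
    using vector_holomorphic_onE[OF vector_derivative_holomorphic[OF \<Omega> d] \<Omega>] w by blast
  from has_derivative_cinner[OF this d[OF w]]
  have 1: "(\<lambda>z. cinner (d z) (\<gamma> z)) differentiable (at w)" by (auto simp: differentiable_def)
  have 2: "(\<lambda>z. cinner (\<gamma> z) (\<gamma> z)) differentiable (at w)"
    using has_derivative_cinner[OF d[OF w] d[OF w]] by (auto simp: differentiable_def)
  have "log_norm_deriv \<gamma> d = (\<lambda>z. cinner (d z) (\<gamma> z) / cinner (\<gamma> z) (\<gamma> z))"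
    by (simp add: fun_eq_iff log_norm_deriv_def cinner_self)
  then show ?thesis using differentiable_divide[OF 1 2] nz[OF w] by simp
qed

lemma section_curvature_eq:
  assumes \<Omega>: "open \<Omega>" and d: "\<And>w. w \<in> \<Omega> \<Longrightarrow> (\<gamma> has_derivative (\<lambda>h. h *\<^sub>C d w)) (at w)"
    and nz: "\<And>w. w \<in> \<Omega> \<Longrightarrow> \<gamma> w \<noteq> 0" and w: "w \<in> \<Omega>"
  shows "section_curvature \<gamma> w = - wirtinger_bar (log_norm_deriv \<gamma> d) w"
proof -
  have "wirtinger (\<lambda>z. complex_of_real (ln ((norm (\<gamma> z))\<^sup>2))) z = log_norm_deriv \<gamma> d z" if "z \<in> \<Omega>" for z
    using wirtinger_of_real[OF has_derivative_log_norm[of \<gamma> d z, OF d nz]] that by blast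
  moreover have "log_norm_deriv \<gamma> d differentiable (at w)"
    using log_norm_deriv_differentiable[OF \<Omega> d nz w] .
  ultimately have "frechet_derivative (log_norm_deriv \<gamma> d) (at w)
      = frechet_derivative (wirtinger (\<lambda>z. complex_of_real (ln ((norm (\<gamma> z))\<^sup>2)))) (at w)"
    by (intro frechet_derivative_transform_within_open[OF _ \<Omega> w]) auto
  then show ?thesis by (simp add: section_curvature_def wirtinger_bar_def)
qed

lemma wirtinger_bar_add:
  assumes "u differentiable (at w)" "v differentiable (at w)"
  shows "wirtinger_bar (\<lambda>z. u z + v z) w = wirtinger_bar u w + wirtinger_bar v w"
proof -
  have "((\<lambda>z. u z + v z) has_derivative
      (\<lambda>h. frechet_derivative u (at w) h + frechet_derivative v (at w) h)) (at w)"
    using assms by (intro has_derivative_add) (simp_all add: frechet_derivative_works)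
  from frechet_derivative_at[OF this, symmetric] show ?thesis
    by (simp add: wirtinger_bar_def add_divide_distrib distrib_left)
qed

text \<open>This is the Cauchy--Riemann equation: a real-linear map \<open>A\<close> of the plane with \<open>A 1 + \<i> A \<i> = 0\<close>
  is multiplication by \<open>A 1\<close>.\<close>

lemma wirtinger_bar_eq_0_iff:
  assumes "u differentiable (at w)"
  shows "wirtinger_bar u w = 0 \<longleftrightarrow> u field_differentiable (at w)"
proof
  let ?A = "frechet_derivative u (at w)"
  have A: "(u has_derivative ?A) (at w)" using assms frechet_derivative_works by blast
  assume "wirtinger_bar u w = 0"
  then have "?A 1 + \<i> * ?A \<i> = 0" by (simp add: wirtinger_bar_def)
  then have "\<i> * (?A 1 + \<i> * ?A \<i>) = 0" by simp
  then have i: "?A \<i> = \<i> * ?A 1" by (simp add: algebra_simps)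
  have lin: "linear ?A" using A has_derivative_linear by blast
  have "?A h = ?A 1 * h" for h
  proof -
    have "?A h = ?A (Re h *\<^sub>R 1 + Im h *\<^sub>R \<i>)"
      by (rule arg_cong[of _ _ ?A]) (simp add: complex_eq_iff)
    also have "\<dots> = Re h *\<^sub>R ?A 1 + Im h *\<^sub>R (\<i> * ?A 1)"
      using lin i by (simp add: linear_add linear_scale)
    also have "\<dots> = ?A 1 * h" by (simp add: complex_eq_iff algebra_simps)
    finally show ?thesis .
  qed
  then have "?A = (*) (?A 1)" by (rule ext)
  from subst[OF this, of "\<lambda>f. (u has_derivative f) (at w)"] A
  have "(u has_derivative (*) (?A 1)) (at w)" by blast
  then show "u field_differentiable (at w)"
    unfolding field_differentiable_def has_field_derivative_def by blast
next
  assume "u field_differentiable (at w)"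
  then obtain u' where "(u has_derivative (*) u') (at w)"
    by (auto simp: field_differentiable_def has_field_derivative_def)
  then have "frechet_derivative u (at w) = (*) u'" by (metis frechet_derivative_at)
  then show "wirtinger_bar u w = 0" by (simp add: wirtinger_bar_def mult.commute)
qed

text \<open>The logarithm of the modulus of a holomorphic function is harmonic, so such a factor does not
  change the curvature. Comparing with the section \<open>\<psi> \<delta>\<close>, which has the same norm as \<open>\<gamma>\<close>, avoids
  differentiating \<open>log |\<psi>|\<^sup>2\<close> separately.\<close>

lemma section_curvature_cong:
  fixes \<gamma> :: "complex \<Rightarrow> 'a::complex_hilbert_space" and \<delta> :: "complex \<Rightarrow> 'b::complex_hilbert_space"
  assumes \<Omega>: "open \<Omega>" and \<gamma>: "vector_holomorphic_on \<gamma> \<Omega>" and \<delta>: "vector_holomorphic_on \<delta> \<Omega>"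
    and \<psi>: "\<psi> holomorphic_on \<Omega>" and nz: "\<And>w. w \<in> \<Omega> \<Longrightarrow> \<gamma> w \<noteq> 0"
    and eq: "\<And>w. w \<in> \<Omega> \<Longrightarrow> norm (\<gamma> w) = cmod (\<psi> w) * norm (\<delta> w)" and w: "w \<in> \<Omega>"
  shows "section_curvature \<gamma> w = section_curvature \<delta> w"
proof -
  obtain d where d: "\<And>w. w \<in> \<Omega> \<Longrightarrow> (\<gamma> has_derivative (\<lambda>h. h *\<^sub>C d w)) (at w)"
    using vector_holomorphic_onE[OF \<gamma> \<Omega>] by blast
  obtain e where e: "\<And>w. w \<in> \<Omega> \<Longrightarrow> (\<delta> has_derivative (\<lambda>h. h *\<^sub>C e w)) (at w)"
    using vector_holomorphic_onE[OF \<delta> \<Omega>] by blast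
  have nz': "\<psi> z \<noteq> 0" "\<delta> z \<noteq> 0" if "z \<in> \<Omega>" for z using eq[OF that] nz[OF that] by auto
  let ?q = "\<lambda>z. deriv \<psi> z / \<psi> z"
  have split: "log_norm_deriv \<gamma> d z = log_norm_deriv \<delta> e z + ?q z" if z: "z \<in> \<Omega>" for z
  proof -
    let ?\<eta> = "\<lambda>z. \<psi> z *\<^sub>C \<delta> z" and ?f = "\<lambda>z. \<psi> z *\<^sub>C e z + deriv \<psi> z *\<^sub>C \<delta> z"
    have "(\<psi> has_derivative (\<lambda>h. deriv \<psi> z * h)) (at z)"
      using holomorphic_derivI[OF \<psi> \<Omega> z] by (simp add: has_field_derivative_def)
    from has_derivative_scaleC[OF this e[OF z]]
    have "(?\<eta> has_derivative (\<lambda>h. h *\<^sub>C ?f z)) (at z)"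
      by (simp add: scaleC_add_right mult.commute)
    then have "((\<lambda>z. ln ((norm (?\<eta> z))\<^sup>2)) has_derivative (\<lambda>h. 2 * Re (h * log_norm_deriv ?\<eta> ?f z))) (at z)"
      by (rule has_derivative_log_norm[of ?\<eta> ?f z]) (use nz'[OF z] in simp)
    then have "((\<lambda>z. ln ((norm (\<gamma> z))\<^sup>2)) has_derivative (\<lambda>h. 2 * Re (h * log_norm_deriv ?\<eta> ?f z))) (at z)"
      by (rule has_derivative_transform_within_open[OF _ \<Omega> z]) (simp add: eq)
    from wirtinger_of_real[OF this]
    have "log_norm_deriv \<gamma> d z = log_norm_deriv ?\<eta> ?f z"
      unfolding wirtinger_of_real[OF has_derivative_log_norm[of \<gamma> d z, OF d[OF z] nz[OF z]]] .
    also have "\<dots> = log_norm_deriv \<delta> e z + ?q z"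
      using nz'[OF z] complex_norm_square[of "\<psi> z"]
      by (simp add: log_norm_deriv_def cinner_add_left cinner_self power_mult_distrib divide_simps)
    finally show ?thesis .
  qed
  have diff: "log_norm_deriv \<delta> e differentiable (at w)"
    by (rule log_norm_deriv_differentiable[OF \<Omega> e nz'(2) w])
  have "?q holomorphic_on \<Omega>"
    using \<psi> \<Omega> nz' by (intro holomorphic_intros) auto
  then have q: "?q field_differentiable (at w)"
    using \<Omega> w holomorphic_on_imp_differentiable_at by blast
  then have q': "?q differentiable (at w)"
    by (auto simp: field_differentiable_def has_field_derivative_def differentiable_def)
  have "frechet_derivative (log_norm_deriv \<gamma> d) (at w)
      = frechet_derivative (\<lambda>z. log_norm_deriv \<delta> e z + ?q z) (at w)"
    by (rule frechet_derivative_transform_within_open[OF _ \<Omega> w])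
      (use split log_norm_deriv_differentiable[OF \<Omega> d nz w] in auto)
  then have "wirtinger_bar (log_norm_deriv \<gamma> d) w = wirtinger_bar (\<lambda>z. log_norm_deriv \<delta> e z + ?q z) w"
    by (simp add: wirtinger_bar_def)
  also have "\<dots> = wirtinger_bar (log_norm_deriv \<delta> e) w"
    using wirtinger_bar_add[OF diff q'] wirtinger_bar_eq_0_iff[OF q'] q by simp
  finally show ?thesis
    using section_curvature_eq[OF \<Omega> d nz w] section_curvature_eq[OF \<Omega> e nz'(2) w] by simp
qed

text \<open>Equal curvature makes \<open>log |\<gamma>|\<^sup>2 - log |\<delta>|\<^sup>2\<close> harmonic. On a disc it is therefore, up to an
  additive constant, the real part of a holomorphic function \<open>2 G\<close>, and a constant multiple of
  \<open>exp G\<close> is the required factor.\<close>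

lemma norm_proportional_of_curvature_eq:
  fixes \<gamma> :: "complex \<Rightarrow> 'a::complex_hilbert_space" and \<delta> :: "complex \<Rightarrow> 'b::complex_hilbert_space"
  assumes \<gamma>: "vector_holomorphic_on \<gamma> (ball c r)" and \<delta>: "vector_holomorphic_on \<delta> (ball c r)"
    and nz: "\<And>w. w \<in> ball c r \<Longrightarrow> \<gamma> w \<noteq> 0" "\<And>w. w \<in> ball c r \<Longrightarrow> \<delta> w \<noteq> 0"
    and curv: "\<And>w. w \<in> ball c r \<Longrightarrow> section_curvature \<gamma> w = section_curvature \<delta> w"
  obtains \<phi> where "\<phi> holomorphic_on ball c r" "\<And>w. \<phi> w \<noteq> 0"
    "\<And>w. w \<in> ball c r \<Longrightarrow> norm (\<gamma> w) = cmod (\<phi> w) * norm (\<delta> w)"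
proof -
  let ?B = "ball c r"
  obtain d where d: "\<And>w. w \<in> ?B \<Longrightarrow> (\<gamma> has_derivative (\<lambda>h. h *\<^sub>C d w)) (at w)"
    using vector_holomorphic_onE[OF \<gamma> open_ball] by blast
  obtain e where e: "\<And>w. w \<in> ?B \<Longrightarrow> (\<delta> has_derivative (\<lambda>h. h *\<^sub>C e w)) (at w)"
    using vector_holomorphic_onE[OF \<delta> open_ball] by blast
  define P where "P = log_norm_deriv \<gamma> d"
  define P' where "P' = log_norm_deriv \<delta> e"
  have diff: "P differentiable (at w)" "P' differentiable (at w)" if "w \<in> ?B" for w
    unfolding P_def P'_def
    using log_norm_deriv_differentiable[where \<Omega> = ?B, OF open_ball d nz(1) that]
      log_norm_deriv_differentiable[where \<Omega> = ?B, OF open_ball e nz(2) that] by auto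
  have "(\<lambda>z. P z + - P' z) field_differentiable (at w)" if w: "w \<in> ?B" for w
  proof -
    have m: "(\<lambda>z. - P' z) differentiable (at w)" using diff(2)[OF w] by simp
    have "wirtinger_bar P w = wirtinger_bar P' w"
      unfolding P_def P'_def
      using section_curvature_eq[where \<Omega> = ?B, OF open_ball d nz(1) w] section_curvature_eq[where \<Omega> = ?B, OF open_ball e nz(2) w]
        curv[OF w] by simp
    moreover have "wirtinger_bar P w = wirtinger_bar (\<lambda>z. P z + - P' z) w + wirtinger_bar P' w"
      using wirtinger_bar_add[OF differentiable_add[OF diff(1)[OF w] m] diff(2)[OF w]] by simp
    ultimately have "wirtinger_bar (\<lambda>z. P z + - P' z) w = 0" by simp
    then show ?thesis by (simp only: wirtinger_bar_eq_0_iff[OF differentiable_add[OF diff(1)[OF w] m]])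
  qed
  then have "(\<lambda>z. P z + - P' z) holomorphic_on ?B"
    by (blast intro: holomorphic_onI field_differentiable_at_within)
  then have hol: "(\<lambda>z. P z - P' z) holomorphic_on ?B" by simp
  then obtain G where G: "\<And>w. w \<in> ?B \<Longrightarrow> (G has_field_derivative P w - P' w) (at w)"
    using holomorphic_convex_primitive'[OF convex_ball open_ball hol]
    by (auto simp only: at_within_open[OF _ open_ball])
  define u where "u z = ln ((norm (\<gamma> z))\<^sup>2) - ln ((norm (\<delta> z))\<^sup>2) - 2 * Re (G z)" for z
  have "(u has_derivative (\<lambda>h. 0)) (at w)" if w: "w \<in> ?B" for w
  proof -
    have "((\<lambda>z. 2 * Re (G z)) has_derivative (\<lambda>h. 2 * Re ((P w - P' w) * h))) (at w)"
      by (rule has_derivative_mult_right[OF has_derivative_Re[OF G[OF w, unfolded has_field_derivative_def]]])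
    from has_derivative_diff[OF has_derivative_diff[OF
          has_derivative_log_norm[of \<gamma> d w, OF d[OF w] nz(1)[OF w]]
          has_derivative_log_norm[of \<delta> e w, OF e[OF w] nz(2)[OF w]]] this]
    show ?thesis unfolding u_def P_def[symmetric] P'_def[symmetric] by (simp add: algebra_simps)
  qed
  then obtain k where k: "\<And>w. w \<in> ?B \<Longrightarrow> u w = k"
    using has_derivative_zero_constant[OF convex_ball, of c r u] has_derivative_at_withinI[of u _ _ ?B]
    by blast
  define \<phi> where "\<phi> z = exp (G z + of_real (k / 2))" for z
  have "G holomorphic_on ?B" using G holomorphic_on_open[OF open_ball] by blast
  then have "\<phi> holomorphic_on ?B" unfolding \<phi>_def by (intro holomorphic_intros)
  moreover have "norm (\<gamma> w) = cmod (\<phi> w) * norm (\<delta> w)" if w: "w \<in> ?B" for w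
  proof -
    have pos: "0 < (norm (\<gamma> w))\<^sup>2" "0 < (norm (\<delta> w))\<^sup>2" using nz w by auto
    have "(cmod (\<phi> w))\<^sup>2 = exp (2 * (Re (G w) + k / 2))"
      by (simp only: \<phi>_def norm_exp_eq_Re power2_eq_square flip: exp_add) simp
    also have "2 * (Re (G w) + k / 2) = ln ((norm (\<gamma> w))\<^sup>2) - ln ((norm (\<delta> w))\<^sup>2)"
      using k[OF w] by (simp add: u_def)
    also have "exp \<dots> = (norm (\<gamma> w))\<^sup>2 / (norm (\<delta> w))\<^sup>2"
      using pos by (simp add: exp_diff del: ln_realpow)
    finally have "(norm (\<gamma> w))\<^sup>2 = (cmod (\<phi> w) * norm (\<delta> w))\<^sup>2"
      using pos by (simp add: power_mult_distrib field_simps)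
    then show ?thesis by (simp add: power2_eq_iff_nonneg)
  qed
  ultimately show ?thesis using that by (auto simp: \<phi>_def)
qed

section \<open>A theorem of Kleinecke--Shirokov type\<close>

lemma funpow_commutator:
  fixes A W Q :: "'a::complex_hilbert_space \<Rightarrow> 'a"
  assumes A: "bounded_clinear A" and AW: "\<And>x. A (W x) = W (A x) + Q x" and AQ: "\<And>x. A (Q x) = Q (A x)"
  shows "(A ^^ Suc k) (W x) = W ((A ^^ Suc k) x) + of_nat (Suc k) *\<^sub>C Q ((A ^^ k) x)"
proof (induction k)
  case (Suc k)
  have "(A ^^ Suc (Suc k)) (W x) = A ((A ^^ Suc k) (W x))" by simp
  also have "\<dots> = A (W ((A ^^ Suc k) x)) + of_nat (Suc k) *\<^sub>C A (Q ((A ^^ k) x))"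
    unfolding Suc.IH by (simp only: bounded_clinear_add[OF A] bounded_clinear_scaleC[OF A])
  also have "\<dots> = W ((A ^^ Suc (Suc k)) x) + (1 *\<^sub>C Q ((A ^^ Suc k) x) + of_nat (Suc k) *\<^sub>C Q ((A ^^ Suc k) x))"
    by (simp add: AW AQ del: of_nat_Suc)
  finally show ?case unfolding scaleC_add_left[symmetric] by simp
qed (simp add: AW)

text \<open>If \<open>Q = [A, W]\<close> commutes with \<open>A\<close>, then \<open>A\<^sup>k W\<^sup>k v = k! q\<^sup>k v\<close> on a common eigenvector \<open>v\<close> of
  \<open>A\<close> and \<open>Q\<close>. The left side grows only geometrically in \<open>k\<close>, which forces \<open>q = 0\<close>.\<close>

lemma commutator_eigenvalue_eq_0:
  fixes A W Q :: "'a::complex_hilbert_space \<Rightarrow> 'a"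
  assumes A: "bounded_clinear A" and W: "bounded_clinear W"
    and AW: "\<And>x. A (W x) = W (A x) + Q x" and AQ: "\<And>x. A (Q x) = Q (A x)"
    and Qs: "\<And>c. Q (c *\<^sub>C v) = c *\<^sub>C Q v"
    and v: "A v = 0" "Q v = q *\<^sub>C v" "v \<noteq> 0"
  shows "q = 0"
proof (rule ccontr)
  assume q: "q \<noteq> 0"
  have pow: "(A ^^ k) ((W ^^ k) v) = (fact k * q ^ k) *\<^sub>C v" for k
  proof (induction k)
    case (Suc k)
    have "(A ^^ Suc k) ((W ^^ Suc k) v) = (A ^^ Suc k) (W ((W ^^ k) v))" by simp
    also have "\<dots> = W ((A ^^ Suc k) ((W ^^ k) v)) + of_nat (Suc k) *\<^sub>C Q ((A ^^ k) ((W ^^ k) v))"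
      by (rule funpow_commutator[where A = A and W = W and Q = Q, OF A AW AQ])
    also have "(A ^^ Suc k) ((W ^^ k) v) = 0"
      by (simp add: Suc.IH bounded_clinear_scaleC[OF A] v)
    also have "Q ((A ^^ k) ((W ^^ k) v)) = (fact k * q ^ k * q) *\<^sub>C v"
      by (simp add: Suc.IH Qs v)
    finally show ?case by (simp add: bounded_clinear_0[OF W] mult_ac)
  qed simp
  have bound: "\<exists>K>0. \<forall>k x. norm ((B ^^ k) x) \<le> K ^ k * norm x"
    if B: "bounded_clinear B" for B :: "'a \<Rightarrow> 'a"
  proof -
    obtain K where K: "0 < K" "\<And>x. norm (B x) \<le> norm x * K"
      using bounded_linear.pos_bounded[OF bounded_clinear_linear[OF B]] by blast
    have "norm ((B ^^ k) x) \<le> K ^ k * norm x" for k x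
    proof (induction k)
      case (Suc k)
      have "norm ((B ^^ Suc k) x) \<le> norm ((B ^^ k) x) * K" using K(2) by simp
      also have "\<dots> \<le> (K ^ k * norm x) * K" using Suc K(1) by (intro mult_right_mono) auto
      finally show ?case by (simp add: mult_ac)
    qed simp
    then show ?thesis using K(1) by blast
  qed
  obtain KA where KA: "0 < KA" "\<And>k x. norm ((A ^^ k) x) \<le> KA ^ k * norm x" using bound[OF A] by blast
  obtain KW where KW: "0 < KW" "\<And>k x. norm ((W ^^ k) x) \<le> KW ^ k * norm x" using bound[OF W] by blast
  define C where "C = KA * KW / cmod q"
  have ge: "1 \<le> C ^ k / fact k" for k
  proof -
    have "fact k * cmod q ^ k * norm v = norm ((A ^^ k) ((W ^^ k) v))"
      by (simp add: pow norm_mult norm_power)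
    also have "\<dots> \<le> KA ^ k * norm ((W ^^ k) v)" by (rule KA(2))
    also have "\<dots> \<le> KA ^ k * (KW ^ k * norm v)" using KA(1) KW(2) by (intro mult_left_mono) auto
    finally have "fact k * cmod q ^ k \<le> (KA * KW) ^ k"
      using v(3) by (simp add: power_mult_distrib flip: mult.assoc)
    then show ?thesis using q by (simp add: C_def power_divide field_simps)
  qed
  have "(\<lambda>k. inverse (fact k) * C ^ k) \<longlonglongrightarrow> 0"
    by (rule summable_LIMSEQ_zero[OF summable_exp])
  then have "\<forall>\<^sub>F k in sequentially. inverse (fact k) * C ^ k < 1"
    by (rule order_tendstoD(2)) simp
  then obtain k where "inverse (fact k) * C ^ k < 1" by (auto simp: eventually_sequentially)
  then show False using ge[of k] by (simp add: field_simps)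
qed

section \<open>Orthogonal sums\<close>

lemma orth_proj_eqI:
  assumes M: "closed_csubspace M" and y: "y \<in> M" "\<And>z. z \<in> M \<Longrightarrow> cinner (x - y) z = 0"
  shows "orth_proj M x = y"
  unfolding orth_proj_def
proof (rule the_equality)
  fix y' assume y': "y' \<in> M \<and> (\<forall>z\<in>M. cinner (x - y') z = 0)"
  then have "y' - y \<in> M"
    using M y(1) by (auto simp: closed_csubspace_def intro: complex_vector.subspace_diff)
  then have "cinner (x - y) (y' - y) - cinner (x - y') (y' - y) = 0" using y y' by simp
  then have "cinner (y' - y) (y' - y) = 0" by (simp add: cinner_diff_left)
  then show "y' = y" by simp
qed (use y in auto)

locale orthogonal_sum =
  fixes n :: nat and H :: "nat \<Rightarrow> 'a::complex_hilbert_space set"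
  assumes decomp: "orthogonal_decomposition n H"
begin

text \<open>The component is extended by zero to indices outside \<open>{1..n}\<close>; shifted index identities then
  hold without side conditions at the ends of the range.\<close>

definition component :: "nat \<Rightarrow> 'a \<Rightarrow> 'a" where
  "component i x = (if i \<in> {1..n} then orth_proj (H i) x else 0)"

lemma closed_H: "i \<in> {1..n} \<Longrightarrow> closed_csubspace (H i)"
  using decomp by (simp add: orthogonal_decomposition_def)

lemma subspace_H: "i \<in> {1..n} \<Longrightarrow> complex_vector.subspace (H i)"
  using closed_H by (simp add: closed_csubspace_def)

lemma orthogonal_H:
  "i \<in> {1..n} \<Longrightarrow> j \<in> {1..n} \<Longrightarrow> i \<noteq> j \<Longrightarrow> x \<in> H i \<Longrightarrow> y \<in> H j \<Longrightarrow> cinner x y = 0"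
  using decomp by (simp add: orthogonal_decomposition_def)

lemma component_outside [simp]: "i \<notin> {1..n} \<Longrightarrow> component i x = 0"
  by (simp only: component_def if_False)

lemma component_unique:
  assumes y: "\<And>i. i \<in> {1..n} \<Longrightarrow> y i \<in> H i" and x: "x = (\<Sum>i=1..n. y i)" and i: "i \<in> {1..n}"
  shows "component i x = y i"
proof -
  have "cinner (x - y i) z = 0" if z: "z \<in> H i" for z
  proof -
    have "x - y i = (\<Sum>j\<in>{1..n} - {i}. y j)" using i by (simp add: x sum_diff1)
    moreover have "cinner (y j) z = 0" if "j \<in> {1..n} - {i}" for j
      using orthogonal_H[of j i "y j" z] that i z y by auto
    ultimately show ?thesis by (simp add: cinner_sum_left)
  qed
  then show ?thesis using i y orth_proj_eqI[OF closed_H[OF i]] by (simp add: component_def)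
qed

lemma component_in: "i \<in> {1..n} \<Longrightarrow> component i x \<in> H i"
  and sum_component: "(\<Sum>i=1..n. component i x) = x"
proof -
  have "\<forall>x. \<exists>y. (\<forall>i\<in>{1..n}. y i \<in> H i) \<and> x = (\<Sum>i=1..n. y i)"
    using decomp unfolding orthogonal_decomposition_def by (elim conjE)
  then obtain y where yH: "\<forall>i\<in>{1..n}. y i \<in> H i" and xy: "x = (\<Sum>i=1..n. y i)"
    by (elim allE[where x = x] exE conjE)
  have y: "\<And>i. i \<in> {1..n} \<Longrightarrow> y i \<in> H i" by (rule bspec[OF yH])
  have eq: "component i x = y i" if "i \<in> {1..n}" for i
    by (rule component_unique[OF y xy that])
  then show "i \<in> {1..n} \<Longrightarrow> component i x \<in> H i" using y(1) by simp
  show "(\<Sum>i=1..n. component i x) = x" using eq xy by simp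
qed

lemma component_eqI:
  assumes "\<And>i. i \<in> {1..n} \<Longrightarrow> component i x = component i y"
  shows "x = y"
proof -
  have "(\<Sum>i=1..n. component i x) = (\<Sum>i=1..n. component i y)" using assms by (rule sum.cong[OF refl])
  then show ?thesis by (simp only: sum_component)
qed

lemma bounded_component: "bounded_clinear (component i)"
proof (cases "i \<in> {1..n}")
  case i: True
  have add: "component i (x + y) = component i x + component i y" for x y
  proof -
    have 1: "component j x + component j y \<in> H j" if "j \<in> {1..n}" for j
      by (rule complex_vector.subspace_add[OF subspace_H[OF that] component_in[OF that] component_in[OF that]])
    have 2: "x + y = (\<Sum>j=1..n. component j x + component j y)"
      unfolding sum.distrib sum_component ..
    show ?thesis by (rule component_unique[OF 1 2 i])
  qed
  have scale: "component i (c *\<^sub>C x) = c *\<^sub>C component i x" for c x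
  proof -
    have 1: "c *\<^sub>C component j x \<in> H j" if "j \<in> {1..n}" for j
      by (rule complex_vector.subspace_scale[OF subspace_H[OF that] component_in[OF that]])
    have 2: "c *\<^sub>C x = (\<Sum>j=1..n. c *\<^sub>C component j x)"
      unfolding complex_vector.scale_sum_right[symmetric] sum_component ..
    show ?thesis by (rule component_unique[OF 1 2 i])
  qed
  have "norm (component i x) \<le> 1 * norm x" for x
  proof -
    let ?y = "component i x"
    have "cinner x ?y = (\<Sum>j=1..n. cinner (component j x) ?y)"
      unfolding cinner_sum_left[symmetric] sum_component ..
    also have "\<dots> = (\<Sum>j=1..n. if j = i then cinner ?y ?y else 0)"
      by (rule sum.cong) (auto intro: orthogonal_H[OF _ i _ component_in component_in[OF i]])
    also have "\<dots> = cinner ?y ?y" using i by (simp only: sum.delta finite_atLeastAtMost if_True)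
    finally have "norm ?y * norm ?y \<le> norm x * norm ?y"
      using norm_cinner_le[of x ?y] by (simp add: cinner_self power2_eq_square norm_mult)
    then show ?thesis by (cases "?y = 0") auto
  qed
  then show ?thesis
    unfolding bounded_operator_def using add scale by blast
next
  case False
  then have "component i = (\<lambda>x. 0)" by (intro ext component_outside)
  then show ?thesis by (simp only: bounded_clinear_zero)
qed

lemmas component_linear =
  bounded_clinear_add[OF bounded_component] bounded_clinear_diff[OF bounded_component]
  bounded_clinear_scaleC[OF bounded_component] bounded_clinear_0[OF bounded_component]
  bounded_clinear_sum[OF bounded_component]

lemma component_H:
  assumes "j \<in> {1..n}" "x \<in> H j"
  shows "component i x = (if i = j then x else 0)"
proof (cases "i \<in> {1..n}")
  case True
  have 1: "(if k = j then x else 0) \<in> H k" if "k \<in> {1..n}" for k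
    using assms complex_vector.subspace_0[OF subspace_H[OF that]] by auto
  have 2: "x = (\<Sum>k=1..n. if k = j then x else 0)"
    using assms(1) by (simp only: sum.delta finite_atLeastAtMost if_True)
  show ?thesis by (rule component_unique[OF 1 2 True])
qed (use assms(1) in auto)

lemma component_component: "component i (component j x) = (if i = j then component i x else 0)"
proof (cases "j \<in> {1..n}")
  case True
  then show ?thesis using component_H[OF True component_in[OF True]] by auto
qed (auto simp: component_linear)

lemma H_iff_component: "j \<in> {1..n} \<Longrightarrow> x \<in> H j \<longleftrightarrow> component j x = x"
  using component_H[of j x j] component_in[of j x] by auto

lemma cinner_component_left: "cinner (component i x) y = cinner (component i x) (component i y)"
proof (cases "i \<in> {1..n}")
  case True
  have "cinner (component i x) y = (\<Sum>j=1..n. cinner (component i x) (component j y))"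
    unfolding cinner_sum_right[symmetric] sum_component ..
  also have "\<dots> = (\<Sum>j=1..n. if j = i then cinner (component i x) (component i y) else 0)"
    by (rule sum.cong) (auto intro: orthogonal_H[OF True _ _ component_in[OF True] component_in])
  also have "\<dots> = cinner (component i x) (component i y)"
    using True by (simp only: sum.delta finite_atLeastAtMost if_True)
  finally show ?thesis .
qed simp

text \<open>The flag \<open>H\<^sub>1 \<oplus> \<dots> \<oplus> H\<^sub>k\<close>.\<close>

definition flag :: "nat \<Rightarrow> 'a set" where
  "flag k = {x. \<forall>i>k. component i x = 0}"

lemma flag_n: "n \<le> k \<Longrightarrow> x \<in> flag k"
  by (simp add: flag_def)

lemma flag_mono: "k \<le> l \<Longrightarrow> flag k \<subseteq> flag l"
  by (auto simp: flag_def)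

lemma flag_component: "component k x \<in> flag k"
  by (simp add: flag_def component_component)

lemma closed_flag: "closed_csubspace (flag k)"
proof -
  have "flag k = (\<Inter>i\<in>{k<..}. component i -` {0})" by (auto simp: flag_def)
  moreover have "closed (component i -` {0})" for i
    using continuous_closed_vimage[of "{0}" "component i"] bounded_clinear_continuous_on[OF bounded_component, of UNIV]
    by (simp add: continuous_on_eq_continuous_at)
  ultimately have "closed (flag k)" by (metis closed_INT)
  then show ?thesis
    by (auto simp: closed_csubspace_def complex_vector.subspace_def flag_def component_linear)
qed

lemma flag_sum:
  assumes "x \<in> flag k" "complex_vector.subspace M" "bounded_clinear f"
    and "\<And>i. i \<in> {1..n} \<Longrightarrow> i \<le> k \<Longrightarrow> f (component i x) \<in> M"
  shows "f x \<in> M"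
proof -
  have "f (component i x) \<in> M" if "i \<in> {1..n}" for i
    using assms that
    by (cases "i \<le> k") (auto simp: flag_def bounded_clinear_0 complex_vector.subspace_0)
  then have "(\<Sum>i=1..n. f (component i x)) \<in> M"
    by (intro complex_vector.subspace_sum[OF assms(2)]) auto
  then show ?thesis
    unfolding bounded_clinear_sum[OF assms(3), of "\<lambda>i. component i x" "{1..n}", symmetric] sum_component .
qed

end

section \<open>Bidiagonal operators as commuting sums\<close>

text \<open>The chain of sections is part of the data: powers of the superdiagonal part lead
  from \<open>t\<^sub>j\<^sub>+\<^sub>k\<close> down to \<open>t\<^sub>j\<close>, and everything that is known about the operator is
  tested on these vectors.\<close>

locale bidiagonal_operator = orthogonal_sum n H
  for n :: nat and H :: "nat \<Rightarrow> 'a::complex_hilbert_space set" +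
  fixes \<Omega> :: "complex set" and T :: "'a \<Rightarrow> 'a" and t :: "nat \<Rightarrow> complex \<Rightarrow> 'a"
  assumes open_\<Omega>: "open \<Omega>" and FB: "FB_class n \<Omega> H T"
    and bidiagonal: "\<And>i j x. i \<in> {1..n} \<Longrightarrow> j \<in> {1..n} \<Longrightarrow> i + 2 \<le> j \<Longrightarrow> x \<in> H j \<Longrightarrow>
      matrix_entry H T i j x = 0"
    and sections: "\<And>i. i \<in> {1..n} \<Longrightarrow> nonvanishing_section \<Omega> (H i) (matrix_entry H T i i) (t i)"
    and chain: "\<And>i w. i \<in> {1..<n} \<Longrightarrow> w \<in> \<Omega> \<Longrightarrow> t i w = matrix_entry H T i (i + 1) (t (i + 1) w)"
begin

lemma bounded_T: "bounded_clinear T"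
  using FB by (simp add: FB_class_def)

definition entry :: "nat \<Rightarrow> nat \<Rightarrow> 'a \<Rightarrow> 'a" where
  "entry i j x = component i (T (component j x))"

lemma bounded_entry: "bounded_clinear (entry i j)"
  unfolding entry_def
  by (intro bounded_clinear_compose[OF bounded_component]
      bounded_clinear_compose[OF bounded_T] bounded_component)

lemma matrix_entry_eq:
  assumes "i \<in> {1..n}" "j \<in> {1..n}"
  shows "matrix_entry H T i j = entry i j"
  unfolding matrix_entry_def entry_def component_def fun_eq_iff using assms by simp

lemma entry_eq_0:
  assumes "i \<noteq> j" "Suc i \<noteq> j"
  shows "entry i j x = 0"
proof (cases "i \<in> {1..n} \<and> j \<in> {1..n}")
  case True
  then have ij: "i \<in> {1..n}" "j \<in> {1..n}" by simp_all
  have "matrix_entry H T i j (component j x) = 0"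
  proof (cases "j < i")
    case True
    with ij show ?thesis using FB component_in[OF ij(2)] unfolding FB_class_def by blast
  next
    case False
    then show ?thesis using assms by (intro bidiagonal ij component_in) simp
  qed
  then show ?thesis unfolding matrix_entry_eq[OF ij] entry_def by (simp add: component_component)
next
  case False
  then consider "i \<notin> {1..n}" | "j \<notin> {1..n}" by blast
  then show ?thesis
  proof cases
    case 1
    then show ?thesis unfolding entry_def by (rule component_outside)
  next
    case 2
    then have "component j x = 0" by (rule component_outside)
    then show ?thesis unfolding entry_def by (simp only: bounded_clinear_0[OF bounded_T] component_linear)
  qed
qed

definition diag :: "'a \<Rightarrow> 'a" where
  "diag x = (\<Sum>i=1..n. entry i i x)"

definition superdiag :: "'a \<Rightarrow> 'a" where
  "superdiag x = T x - diag x"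

lemma T_eq: "T x = diag x + superdiag x"
  by (simp add: superdiag_def)

lemma bounded_diag: "bounded_clinear diag"
  unfolding diag_def by (intro bounded_clinear_sum_fun bounded_entry)

lemma bounded_superdiag: "bounded_clinear superdiag"
  unfolding superdiag_def by (intro bounded_clinear_sub bounded_T bounded_diag)

lemmas diag_linear =
  bounded_clinear_add[OF bounded_diag] bounded_clinear_diff[OF bounded_diag]
  bounded_clinear_scaleC[OF bounded_diag] bounded_clinear_0[OF bounded_diag]

lemmas superdiag_linear =
  bounded_clinear_add[OF bounded_superdiag] bounded_clinear_diff[OF bounded_superdiag]
  bounded_clinear_scaleC[OF bounded_superdiag] bounded_clinear_0[OF bounded_superdiag]

lemma entry_outside: "i \<notin> {1..n} \<Longrightarrow> entry i j x = 0"
  unfolding entry_def by (rule component_outside)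

lemma component_entry: "component k (entry i j x) = (if k = i then entry i j x else 0)"
  unfolding entry_def component_component by simp

lemma entry_component: "entry i j (component k x) = (if j = k then entry i j x else 0)"
  unfolding entry_def component_component
  by (simp add: bounded_clinear_0[OF bounded_T] component_linear)

lemma component_diag: "component i (diag x) = entry i i x"
proof (cases "i \<in> {1..n}")
  case True
  have "component i (diag x) = (\<Sum>j=1..n. if i = j then entry j j x else 0)"
    unfolding diag_def component_linear(5) component_entry ..
  also have "\<dots> = entry i i x" using True by (simp only: sum.delta' finite_atLeastAtMost if_True)
  finally show ?thesis .
next
  case False
  then show ?thesis by (simp only: component_outside[OF False] entry_outside[OF False])
qed

lemma diag_component: "diag (component i x) = entry i i x"
proof (cases "i \<in> {1..n}")
  case True
  have "diag (component i x) = (\<Sum>j=1..n. if j = i then entry j j x else 0)"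
    unfolding diag_def entry_component ..
  also have "\<dots> = entry i i x" using True by (simp only: sum.delta finite_atLeastAtMost if_True)
  finally show ?thesis .
next
  case False
  then show ?thesis by (simp only: component_outside[OF False] entry_outside[OF False] diag_linear)
qed

lemma component_diag_swap: "component i (diag x) = diag (component i x)"
  by (simp only: component_diag diag_component)

lemma component_T: "component i (T x) = entry i i x + entry i (Suc i) x"
proof (cases "i \<in> {1..n}")
  case True
  have "component i (T x) = component i (T (\<Sum>j=1..n. component j x))" by (simp only: sum_component)
  also have "\<dots> = (\<Sum>j=1..n. entry i j x)"
    unfolding bounded_clinear_sum[OF bounded_T] component_linear(5) entry_def ..
  also have "\<dots> = (\<Sum>j=1..Suc n. entry i j x)"
    using entry_eq_0[of i "Suc n" x] True entry_component[of i "Suc n" "Suc n" x]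
    by (cases "i = n") (auto simp: component_outside bounded_clinear_0[OF bounded_entry])
  also have "\<dots> = (\<Sum>j\<in>{i, Suc i}. entry i j x)"
    using True entry_eq_0 by (intro sum.mono_neutral_right) auto
  finally show ?thesis by simp
qed (simp add: component_outside entry_outside)

lemma component_superdiag: "component i (superdiag x) = entry i (Suc i) x"
  by (simp add: superdiag_def component_linear component_T component_diag)

lemma superdiag_component: "superdiag (component (Suc i) x) = entry i (Suc i) x"
proof (rule component_eqI)
  fix k show "component k (superdiag (component (Suc i) x)) = component k (entry i (Suc i) x)"
    unfolding component_superdiag component_entry entry_component by auto
qed

lemma component_superdiag_swap: "component i (superdiag x) = superdiag (component (Suc i) x)"
  by (simp only: component_superdiag superdiag_component)

lemma superdiag_component_0: "superdiag (component 0 x) = 0" "superdiag (component 1 x) = 0"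
proof -
  have "component 0 x = 0" by (rule component_outside) simp
  then show "superdiag (component 0 x) = 0" by (simp only: superdiag_linear)
  show "superdiag (component 1 x) = 0"
    using superdiag_component[of 0 x] entry_outside[of 0 "Suc 0" x] by simp
qed

text \<open>The intertwining relations \<open>T\<^sub>i\<^sub>i T\<^sub>i\<^sub>,\<^sub>i\<^sub>+\<^sub>1 = T\<^sub>i\<^sub>,\<^sub>i\<^sub>+\<^sub>1 T\<^sub>i\<^sub>+\<^sub>1\<^sub>,\<^sub>i\<^sub>+\<^sub>1\<close> say precisely that the two summands
  of \<open>T\<close> commute.\<close>

lemma diag_superdiag: "diag (superdiag x) = superdiag (diag x)"
proof (rule component_eqI)
  fix i assume i: "i \<in> {1..n}"
  let ?y = "component (Suc i) x"
  have "entry i i (entry i (Suc i) ?y) = entry i (Suc i) (entry (Suc i) (Suc i) ?y)"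
  proof (cases "Suc i \<in> {1..n}")
    case True
    then have "i \<in> {1..<n}" using i by simp
    then have "\<forall>x\<in>H (Suc i). matrix_entry H T i i (matrix_entry H T i (Suc i) x) =
        matrix_entry H T i (Suc i) (matrix_entry H T (Suc i) (Suc i) x)"
      using FB unfolding FB_class_def Suc_eq_plus1 by blast
    then show ?thesis using component_in[OF True] by (simp only: matrix_entry_eq i True)
  next
    case False
    then show ?thesis
      by (simp only: component_outside[OF False] bounded_clinear_0[OF bounded_entry])
  qed
  then have "entry i i (entry i (Suc i) x) = entry i (Suc i) (entry (Suc i) (Suc i) x)"
    by (simp add: entry_component)
  moreover have "component i (diag (superdiag x)) = entry i i (entry i (Suc i) x)"
    unfolding component_diag_swap component_superdiag
    unfolding diag_component[symmetric] component_entry by simp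
  moreover have "component i (superdiag (diag x)) = entry i (Suc i) (entry (Suc i) (Suc i) x)"
    unfolding component_superdiag_swap component_diag
    unfolding superdiag_component[symmetric] component_entry by simp
  ultimately show "component i (diag (superdiag x)) = component i (superdiag (diag x))" by simp
qed

lemma funpow_swap: "(\<And>x. f (g x) = g (f x)) \<Longrightarrow> (f ^^ k) (g x) = g ((f ^^ k) x)"
  by (induction k) simp_all

lemma component_superdiag_pow: "component i ((superdiag ^^ k) x) = (superdiag ^^ k) (component (i + k) x)"
proof (induction k arbitrary: i)
  case (Suc k)
  show ?case using component_superdiag_swap[of i "(superdiag ^^ k) x"] Suc[of "Suc i"] by simp
qed simp

lemma superdiag_nilpotent: "(superdiag ^^ n) x = 0"
proof (rule component_eqI)
  fix i assume "i \<in> {1..n}"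
  then have "component (i + n) x = 0" by (intro component_outside) simp
  then show "component i ((superdiag ^^ n) x) = component i 0"
    by (simp only: component_superdiag_pow bounded_clinear_0[OF bounded_clinear_pow[OF bounded_superdiag]] component_linear)
qed

lemma section_in: "i \<in> {1..n} \<Longrightarrow> w \<in> \<Omega> \<Longrightarrow> t i w \<in> H i"
  and section_nonzero: "i \<in> {1..n} \<Longrightarrow> w \<in> \<Omega> \<Longrightarrow> t i w \<noteq> 0"
  and section_holomorphic: "i \<in> {1..n} \<Longrightarrow> vector_holomorphic_on (t i) \<Omega>"
  using sections by (auto simp: nonvanishing_section_def eigenspace_def)

lemma component_section: "i \<in> {1..n} \<Longrightarrow> w \<in> \<Omega> \<Longrightarrow> component i (t i w) = t i w"
  using component_H[of i "t i w" i] section_in by simp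

lemma diag_H: "i \<in> {1..n} \<Longrightarrow> x \<in> H i \<Longrightarrow> diag x = matrix_entry H T i i x"
  using diag_component[of i x] component_H[of i x i] matrix_entry_eq[of i i] by simp

lemma eigenspace_eq: "i \<in> {1..n} \<Longrightarrow> eigenspace (H i) (matrix_entry H T i i) w = {x \<in> H i. diag x = w *\<^sub>C x}"
  unfolding eigenspace_def using diag_H by auto

lemma diag_section: "i \<in> {1..n} \<Longrightarrow> w \<in> \<Omega> \<Longrightarrow> diag (t i w) = w *\<^sub>C t i w"
  using sections[of i] eigenspace_eq[of i w] by (auto simp: nonvanishing_section_def)

lemma superdiag_section: "i \<in> {1..<n} \<Longrightarrow> w \<in> \<Omega> \<Longrightarrow> superdiag (t (Suc i) w) = t i w"
  using chain[of i w] superdiag_component[of i "t (Suc i) w"] component_section[of "Suc i" w]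
    matrix_entry_eq[of i "Suc i"] by simp

lemma superdiag_section_first: "1 \<le> n \<Longrightarrow> w \<in> \<Omega> \<Longrightarrow> superdiag (t 1 w) = 0"
  using superdiag_component_0(2)[of "t 1 w"] component_section[of 1 w] by simp

lemma superdiag_pow_section: "1 \<le> j \<Longrightarrow> j + k \<le> n \<Longrightarrow> w \<in> \<Omega> \<Longrightarrow> (superdiag ^^ k) (t (j + k) w) = t j w"
proof (induction k)
  case (Suc k)
  have "(superdiag ^^ Suc k) (t (j + Suc k) w) = (superdiag ^^ k) (superdiag (t (Suc (j + k)) w))"
    by (simp add: funpow_swap)
  then show ?case using superdiag_section[of "j + k" w] Suc by simp
qed simp

text \<open>Membership of the diagonal blocks in the Cowen--Douglas class with multiplicity one enters here:
  their eigenspaces are lines.\<close>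

lemma eigenvector_multiple:
  assumes i: "i \<in> {1..n}" and w: "w \<in> \<Omega>" and x: "x \<in> H i" "diag x = w *\<^sub>C x"
  obtains c where "x = c *\<^sub>C t i w"
proof -
  let ?V = "eigenspace (H i) (matrix_entry H T i i) w"
  have "complex_vector.dim ?V = 1"
    using FB i w unfolding FB_class_def cowen_douglas_def by blast
  then obtain B where B: "B \<subseteq> ?V" "?V \<subseteq> complex_vector.span B" "card B = 1"
    using complex_vector.basis_exists[of ?V] by metis
  then obtain b where b: "B = {b}" using card_1_singletonE by metis
  have multiple: "\<exists>e. y = e *\<^sub>C b" if "y \<in> ?V" for y
    using that B(2) unfolding b complex_vector.span_singleton by blast
  have "t i w \<in> ?V" using sections[OF i] w by (simp add: nonvanishing_section_def)
  then obtain e where e: "t i w = e *\<^sub>C b" using multiple by blast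
  have "x \<in> ?V" using x eigenspace_eq[OF i] by simp
  then obtain e' where e': "x = e' *\<^sub>C b" using multiple by blast
  have "e \<noteq> 0" using e section_nonzero[OF i w] by auto
  then have "x = (e' / e) *\<^sub>C t i w" using e e' by simp
  then show ?thesis using that by blast
qed

lemma maps_H_into:
  assumes i: "i \<in> {1..n}" and f: "bounded_clinear f" and M: "closed_csubspace M"
    and sec: "\<And>w. w \<in> \<Omega> \<Longrightarrow> f (t i w) \<in> M" and x: "x \<in> H i"
  shows "f x \<in> M"
proof (rule bounded_clinear_closure_span[OF f _ M])
  let ?S = "\<Union>w\<in>\<Omega>. eigenspace (H i) (matrix_entry H T i i) w"
  have "closure (complex_vector.span ?S) = H i"
    using FB i unfolding FB_class_def cowen_douglas_def by blast
  then show "x \<in> closure (complex_vector.span ?S)" using x by simp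
  fix y assume "y \<in> ?S"
  then obtain w where w: "w \<in> \<Omega>" "y \<in> H i" "diag y = w *\<^sub>C y" using eigenspace_eq[OF i] by auto
  then obtain c where "y = c *\<^sub>C t i w" using eigenvector_multiple[OF i] by blast
  then show "f y \<in> M"
    using sec[OF w(1)] M
    by (simp add: bounded_clinear_scaleC[OF f] closed_csubspace_def complex_vector.subspace_scale)
qed

lemma eq_0_on_component:
  assumes f: "bounded_clinear f" and sec: "\<And>w. j \<in> {1..n} \<Longrightarrow> w \<in> \<Omega> \<Longrightarrow> f (t j w) = 0"
  shows "f (component j x) = 0"
proof (cases "j \<in> {1..n}")
  case True
  have "f (t j w) \<in> {0}" if "w \<in> \<Omega>" for w using sec[OF True that] by (simp only: singleton_iff)
  then have "f (component j x) \<in> {0}"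
    by (rule maps_H_into[OF True f closed_csubspace_zero _ component_in[OF True]])
  then show ?thesis by (rule singletonD)
next
  case False
  then show ?thesis by (simp only: component_outside[OF False] bounded_clinear_0[OF f])
qed

end

section \<open>Operators commuting with a bidiagonal operator\<close>

context bidiagonal_operator
begin

context
  fixes X :: "'a \<Rightarrow> 'a"
  assumes bounded_X: "bounded_clinear X" and commute: "\<And>x. X (T x) = T (X x)"
begin

private definition block :: "nat \<Rightarrow> nat \<Rightarrow> 'a \<Rightarrow> 'a" where
  "block i j x = component i (X (component j x))"

lemma bounded_block: "bounded_clinear (block i j)"
  unfolding block_def
  by (intro bounded_clinear_compose[OF bounded_component]
      bounded_clinear_compose[OF bounded_X] bounded_component)

lemmas block_linear =
  bounded_clinear_diff[OF bounded_block] bounded_clinear_scaleC[OF bounded_block]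
  bounded_clinear_0[OF bounded_block]

lemma block_outside: "i \<notin> {1..n} \<or> j \<notin> {1..n} \<Longrightarrow> block i j x = 0"
  unfolding block_def by (auto simp: component_linear bounded_clinear_0[OF bounded_X])

lemma block_component: "block i j (component j x) = block i j x"
  by (simp add: block_def component_component)

text \<open>Only two diagonals of \<open>T\<close> are non-zero, so a block of the relation \<open>T X = X T\<close> couples each
  diagonal of \<open>X\<close> with the next lower one only.\<close>

lemma block_commutator:
  "diag (block i (Suc j) x) + superdiag (block (Suc i) (Suc j) x)
    = block i (Suc j) (diag x) + block i j (superdiag x)"
proof -
  have "component i (T (X (component (Suc j) x))) = component i (X (T (component (Suc j) x)))"
    by (simp only: commute)
  moreover have "component i (T y) = diag (component i y) + superdiag (component (Suc i) y)" for y
    by (simp only: component_T diag_component superdiag_component)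
  moreover have "T (component (Suc j) x) = component (Suc j) (diag x) + component j (superdiag x)"
    by (simp only: T_eq component_diag_swap component_superdiag_swap)
  ultimately show ?thesis
    by (simp only: block_def bounded_clinear_add[OF bounded_X] component_linear)
qed

lemma block_diag:
  assumes "\<And>j x. block (j + Suc d) j x = 0"
  shows "diag (block (j + d) j x) = block (j + d) j (diag x)"
proof (cases j)
  case 0
  then show ?thesis by (simp add: block_outside diag_linear)
next
  case (Suc l)
  have "block (Suc (j + d)) j x = 0" "block (j + d) l (superdiag x) = 0"
    using assms[of j x] assms[of l "superdiag x"] Suc by simp_all
  then show ?thesis using block_commutator[of "j + d" l x] by (simp add: Suc superdiag_linear)
qed

lemma block_section:
  assumes "\<And>j x. block (j + Suc d) j x = 0" and "j \<in> {1..n}" "w \<in> \<Omega>" "j + d \<le> n"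
  obtains c where "block (j + d) j (t j w) = c *\<^sub>C t (j + d) w"
proof (rule eigenvector_multiple[of "j + d" w "block (j + d) j (t j w)"])
  show i: "j + d \<in> {1..n}" using assms by simp
  show "block (j + d) j (t j w) \<in> H (j + d)"
    unfolding block_def by (rule component_in[OF i])
  show "diag (block (j + d) j (t j w)) = w *\<^sub>C block (j + d) j (t j w)"
    unfolding block_diag[OF assms(1)] diag_section[OF assms(2,3)] block_linear ..
qed (use assms(3) that in auto)

text \<open>The induction goes from the lowest diagonal upwards. If all blocks below the diagonal
  \<open>i - j = e + 1\<close> vanish, the blocks \<open>Z\<close> on it intertwine the diagonal parts, so they act on sections by scalars; one
  diagonal further up, the commutator of the block \<open>Y\<close> with the diagonal part is expressed
  by these scalars. Composing with the power of the superdiagonal part that leads back from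
  \<open>H\<^sub>i\<close> to \<open>H\<^sub>j\<close> turns this commutator into one of operators on the same space, to which
  \<open>commutator_eigenvalue_eq_0\<close> applies.\<close>

lemma block_lower_step:
  assumes below: "\<And>j x. block (j + Suc (Suc e)) j x = 0"
  shows "block (j + Suc e) j x = 0"
proof -
  have "block (j + Suc e) j (t j w) = 0" if w: "w \<in> \<Omega>" for j w
  proof (induction j)
    case 0
    show ?case by (simp add: block_outside)
  next
    case (Suc l)
    let ?j = "Suc l"
    let ?Z = "\<lambda>j. block (j + Suc e) j" and ?Y = "block (?j + e) ?j" and ?N = "superdiag ^^ e"
    show ?case
    proof (cases "?j + Suc e \<le> n")
      case False
      then show ?thesis by (simp add: block_outside)
    next
      case le: True
      have j: "?j \<in> {1..n}" using le by simp
      obtain c where c: "?Z ?j (t ?j w) = c *\<^sub>C t (?j + Suc e) w"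
        by (rule block_section[OF below j w le])
      \<comment> \<open>\<open>W\<close> maps \<open>H\<^sub>j\<close> to itself, and \<open>Q\<close> is its commutator with \<open>A\<close>; on \<open>t\<^sub>j\<close> only the second term of
        \<open>Q\<close> survives, since the first one vanishes by the induction hypothesis for \<open>l\<close>.\<close>
      define A where "A x = diag x - w *\<^sub>C x" for x
      define W where "W x = ?N (?Y x)" for x
      define Q where "Q x = ?N (?Z l (superdiag x) - superdiag (?Z ?j x))" for x
      have bN: "bounded_clinear ?N" by (rule bounded_clinear_pow[OF bounded_superdiag])
      note N_linear = bounded_clinear_add[OF bN] bounded_clinear_diff[OF bN] bounded_clinear_scaleC[OF bN]
      have dN: "diag (?N x) = ?N (diag x)" for x
        by (rule funpow_swap[symmetric]) (rule diag_superdiag[symmetric])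
      have Y: "diag (?Y x) = ?Y (diag x) + (?Z l (superdiag x) - superdiag (?Z ?j x))" for x
        using block_commutator[of "?j + e" l x] by (simp add: algebra_simps)
      have bA: "bounded_clinear A" unfolding A_def
        by (intro bounded_clinear_sub bounded_diag bounded_clinear_scale)
      have bW: "bounded_clinear W" unfolding W_def
        by (rule bounded_clinear_compose[OF bN bounded_block])
      have AW: "A (W x) = W (A x) + Q x" for x
        unfolding A_def W_def Q_def dN Y N_linear block_linear by simp
      have AQ: "A (Q x) = Q (A x)" for x
        unfolding A_def Q_def dN diag_linear diag_superdiag block_diag[OF below]
          N_linear superdiag_linear block_linear
        by (simp only: superdiag_linear block_linear complex_vector.scale_right_diff_distrib) simp
      have Qs: "Q (a *\<^sub>C x) = a *\<^sub>C Q x" for a x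
        unfolding Q_def
        by (simp only: superdiag_linear block_linear N_linear complex_vector.scale_right_diff_distrib)
      have At: "A (t ?j w) = 0" by (simp add: A_def diag_section[OF j w])
      have Qt: "Q (t ?j w) = (- c) *\<^sub>C t ?j w"
      proof -
        have "?Z l (superdiag (t ?j w)) = 0"
        proof (cases "l = 0")
          case False
          then have "superdiag (t ?j w) = t l w" using superdiag_section[of l w] le w by simp
          then show ?thesis using Suc.IH by simp
        qed (simp add: block_outside)
        moreover have "?N (superdiag (?Z ?j (t ?j w))) = c *\<^sub>C t ?j w"
        proof -
          have "?N (superdiag (t (?j + Suc e) w)) = (superdiag ^^ Suc e) (t (?j + Suc e) w)"
            by (simp add: funpow_swap)
          also have "\<dots> = t ?j w" by (rule superdiag_pow_section[OF _ le w]) simp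
          finally show ?thesis by (simp only: c superdiag_linear N_linear)
        qed
        ultimately show ?thesis
          unfolding Q_def N_linear by (simp add: bounded_clinear_0[OF bN])
      qed
      have "- c = 0"
        by (rule commutator_eigenvalue_eq_0[where A = A and W = W and Q = Q,
              OF bA bW AW AQ Qs At Qt section_nonzero[OF j w]])
      then show ?thesis unfolding c by simp
    qed
  qed
  then have "block (j + Suc e) j (component j x) = 0"
    by (rule eq_0_on_component[where f = "block (j + Suc e) j", OF bounded_block])
  then show ?thesis by (simp only: block_component)
qed

lemma block_lower: "block (j + Suc e) j x = 0"
proof (cases "e \<le> n")
  case True
  then have "\<forall>j x. block (j + Suc e) j x = 0"
  proof (induction rule: inc_induct)
    case base
    then show ?case by (simp add: block_outside)
  next
    case (step e)
    then show ?case using block_lower_step[of e] by simp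
  qed
  then show ?thesis by blast
qed (simp add: block_outside)

text \<open>Modulo the preceding space of the flag, the scalar by which a diagonal block acts on a section is
  an eigenvalue of \<open>X\<close>; it vanishes when \<open>X\<close> is nilpotent.\<close>

lemma block_diagonal_nilpotent:
  assumes nil: "\<And>x. (X ^^ m) x = 0"
  shows "block j j x = 0"
proof -
  have "block j j (t j w) = 0" if j: "j \<in> {1..n}" and w: "w \<in> \<Omega>" for w
  proof -
    have le: "j + 0 \<le> n" using j by simp
    have below: "\<And>j x. block (j + Suc 0) j x = 0" by (rule block_lower)
    obtain c where "block (j + 0) j (t j w) = c *\<^sub>C t (j + 0) w"
      by (rule block_section[OF below j w le])
    then have c: "block j j (t j w) = c *\<^sub>C t j w" by simp
    have "component j ((X ^^ k) (t j w)) = c ^ k *\<^sub>C t j w \<and> (X ^^ k) (t j w) \<in> flag j" for k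
    proof (induction k)
      case 0
      show ?case using flag_component[of j "t j w"] by (simp add: component_section[OF j w])
    next
      case (Suc k)
      let ?y = "(X ^^ k) (t j w)"
      have y: "X ?y = (\<Sum>l=1..n. X (component l ?y))"
        unfolding bounded_clinear_sum[OF bounded_X, symmetric] sum_component ..
      have i: "component i (X ?y) = (if i = j then block j j ?y else 0)" if ij: "j \<le> i" for i
      proof -
        have "component i (X (component l ?y)) = (if l = j then (if i = j then block j j ?y else 0) else 0)" for l
        proof (cases l j rule: linorder_cases)
          case less
          then have "i = l + Suc (i - Suc l)" using ij by simp
          then have "block i l ?y = 0" by (metis block_lower)
          then show ?thesis using less by (simp add: block_def)
        next
          case equal
          show ?thesis
          proof (cases "i = j")
            case False
            then have "i = j + Suc (i - Suc j)" using ij by simp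
            then have "block i j ?y = 0" by (metis block_lower)
            then show ?thesis using equal False by (simp add: block_def)
          qed (simp add: equal block_def)
        next
          case greater
          then have "component l ?y = 0" using Suc by (simp add: flag_def)
          then show ?thesis using greater by (simp add: bounded_clinear_0[OF bounded_X] component_linear)
        qed
        then have "component i (X ?y) = (\<Sum>l=1..n. if l = j then (if i = j then block j j ?y else 0) else 0)"
          unfolding y component_linear by (rule sum.cong[OF refl])
        also have "\<dots> = (if i = j then block j j ?y else 0)"
          using j by (simp only: sum.delta finite_atLeastAtMost if_True)
        finally show ?thesis .
      qed
      have "block j j ?y = block j j (component j ?y)" by (simp only: block_component)
      also have "\<dots> = c ^ Suc k *\<^sub>C t j w" using Suc c by (simp add: block_linear mult.commute)
      finally show ?case using i by (simp add: flag_def)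
    qed
    from this[of m] have "c ^ m *\<^sub>C t j w = 0" by (simp add: nil component_linear)
    then have "c ^ m = 0" using section_nonzero[OF j w] complex_vector.scale_eq_0_iff by blast
    then show ?thesis using c by (simp add: power_eq_0_iff)
  qed
  then have "block j j (component j x) = 0"
    by (rule eq_0_on_component[where f = "block j j", OF bounded_block])
  then show ?thesis by (simp only: block_component)
qed

text \<open>Both the lower blocks and the diagonal blocks of \<open>X\<close> are zero, so each application of \<open>X\<close> moves one
  step down the flag.\<close>

lemma nilpotent_lowers_flag:
  assumes nil: "\<And>x. (X ^^ m) x = 0" and x: "x \<in> flag (k + l)"
  shows "(X ^^ l) x \<in> flag k"
  using x
proof (induction l arbitrary: k)
  case (Suc l)
  let ?y = "(X ^^ l) x"
  have y: "?y \<in> flag (Suc k)" using Suc by simp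
  have "component i (X ?y) = 0" if i: "k < i" for i
  proof -
    have "component i (X (component j ?y)) = 0" for j
    proof (cases "j < i")
      case True
      then have "i = j + Suc (i - Suc j)" by simp
      then show ?thesis using block_lower[of j "i - Suc j" ?y] by (simp add: block_def)
    next
      case ge: False
      show ?thesis
      proof (cases "i = j")
        case True
        then show ?thesis using block_diagonal_nilpotent[OF nil, of j ?y] by (simp add: block_def)
      next
        case False
        then have "component j ?y = 0" using y i ge by (simp add: flag_def)
        then show ?thesis by (simp add: bounded_clinear_0[OF bounded_X] component_linear)
      qed
    qed
    then have "(\<Sum>j=1..n. component i (X (component j ?y))) = 0" by simp
    then show ?thesis
      unfolding component_linear(5)[symmetric] bounded_clinear_sum[OF bounded_X, symmetric] sum_component .
  qed
  then show ?case by (simp add: flag_def)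
qed simp

end

end

section \<open>Unitary equivalence\<close>

lemma unitary_inverse:
  assumes "unitary U"
  obtains V where "bounded_clinear V" "\<And>x. V (U x) = x" "\<And>y. U (V y) = y"
proof -
  have U: "bounded_clinear U" and surj: "surj U" and iso: "\<And>x y. cinner (U x) (U y) = cinner x y"
    using assms by (auto simp: unitary_def)
  have norm: "norm (U x) = norm x" for x
    using iso[of x x] by (simp add: cinner_self power2_eq_iff_nonneg del: of_real_power)
  have inj: "x = y" if "U x = U y" for x y
    using norm[of "x - y"] that by (simp add: bounded_clinear_diff[OF U])
  define V where "V = inv U"
  have UV: "U (V y) = y" for y using surj by (simp add: V_def surj_f_inv_f)
  have VU: "V (U x) = x" for x using UV[of "U x"] by (rule inj)
  have "V (x + y) = V x + V y" for x y
    by (rule inj) (simp add: UV bounded_clinear_add[OF U])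
  moreover have "V (c *\<^sub>C x) = c *\<^sub>C V x" for c x
    by (rule inj) (simp add: UV bounded_clinear_scaleC[OF U])
  moreover have "norm (V x) \<le> 1 * norm x" for x
    using norm[of "V x"] by (simp add: UV)
  ultimately have "bounded_clinear V" unfolding bounded_operator_def by blast
  then show ?thesis using that VU UV by blast
qed

text \<open>The section chosen in the definition of the curvature differs from the given one by a
  holomorphic factor.\<close>

lemma (in bidiagonal_operator) curvature_eq_section_curvature:
  assumes i: "i \<in> {1..n}" and w: "w \<in> \<Omega>"
  shows "curvature \<Omega> (H i) (matrix_entry H T i i) w = section_curvature (t i) w"
proof -
  define \<gamma> where "\<gamma> = (SOME \<gamma>. nonvanishing_section \<Omega> (H i) (matrix_entry H T i i) \<gamma>)"
  have \<gamma>: "nonvanishing_section \<Omega> (H i) (matrix_entry H T i i) \<gamma>"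
    unfolding \<gamma>_def by (rule someI[of _ "t i"]) (rule sections[OF i])
  have hol: "vector_holomorphic_on \<gamma> \<Omega>" and nz: "\<And>w. w \<in> \<Omega> \<Longrightarrow> \<gamma> w \<noteq> 0"
    using \<gamma> by (simp_all add: nonvanishing_section_def)
  have line: "\<exists>c. \<gamma> w = c *\<^sub>C t i w" if "w \<in> \<Omega>" for w
  proof -
    have "\<gamma> w \<in> eigenspace (H i) (matrix_entry H T i i) w"
      using \<gamma> that by (simp add: nonvanishing_section_def)
    then show ?thesis
      using eigenvector_multiple[OF i that, of "\<gamma> w"] eigenspace_eq[OF i] by blast
  qed
  obtain f where f: "f holomorphic_on \<Omega>" "\<And>w. w \<in> \<Omega> \<Longrightarrow> \<gamma> w = f w *\<^sub>C t i w"
    by (rule proportional_sections[OF open_\<Omega> hol section_holomorphic[OF i] line section_nonzero[OF i]])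
      (assumption | (rule that; blast))+
  have "section_curvature \<gamma> w = section_curvature (t i) w"
    by (rule section_curvature_cong[OF open_\<Omega> hol section_holomorphic[OF i] f(1) nz _ w])
      (simp_all add: f(2))
  then show ?thesis by (simp add: curvature_def \<gamma>_def)
qed

lemma (in bidiagonal_operator) T_section:
  assumes "i \<in> {1..n}" "w \<in> \<Omega>"
  shows "T (t i w) = w *\<^sub>C t i w + (if i = 1 then 0 else t (i - 1) w)"
proof (cases "i = 1")
  case True
  then show ?thesis using assms superdiag_section_first[of w] diag_section[OF assms] by (simp add: T_eq)
next
  case False
  then obtain l where "i = Suc l" using assms by (cases i) auto
  then show ?thesis
    using False assms superdiag_section[of l w] diag_section[OF assms] by (simp add: T_eq)
qed

text \<open>By the identity theorem the sections over any non-empty open part of \<open>\<Omega>\<close> already span a dense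
  subspace.\<close>

lemma (in bidiagonal_operator) dense_sections:
  assumes conn: "connected \<Omega>" and D: "open D" "D \<subseteq> \<Omega>" "D = {} \<Longrightarrow> \<Omega> = {}"
    and \<phi>: "\<And>w. w \<in> D \<Longrightarrow> \<phi> w \<noteq> 0"
  shows "closure (complex_vector.span ((\<lambda>(i, w). \<phi> w *\<^sub>C t i w) ` ({1..n} \<times> D))) = UNIV"
proof (rule closure_span_eq_UNIV)
  fix y assume y: "\<And>x. x \<in> (\<lambda>(i, w). \<phi> w *\<^sub>C t i w) ` ({1..n} \<times> D) \<Longrightarrow> cinner x y = 0"
  have orth: "cinner (t i w) y = 0" if i: "i \<in> {1..n}" and w: "w \<in> \<Omega>" for i w
  proof (rule analytic_continuation_open[OF D(1) open_\<Omega> _ conn D(2) _ holomorphic_on_const _ w])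
    show "D \<noteq> {}" using D(3) w by blast
    show "(\<lambda>w. cinner (t i w) y) holomorphic_on \<Omega>"
      by (rule holomorphic_cinner[OF section_holomorphic[OF i] open_\<Omega>])
    fix z assume z: "z \<in> D"
    have "cinner (\<phi> z *\<^sub>C t i z) y = 0"
      by (rule y) (use i z in force)
    then show "cinner (t i z) y = 0" using \<phi>[OF z] by simp
  qed
  have id: "bounded_clinear (\<lambda>x::'a. x)"
    using bounded_clinear_scale[of 1] by simp
  have "cinner (component i y) y = 0" if i: "i \<in> {1..n}" for i
  proof -
    have "component i y \<in> {x. cinner x y = 0}"
      by (rule maps_H_into[OF i id closed_csubspace_orthogonal _ component_in[OF i]])
        (simp add: orth[OF i])
    then show ?thesis by simp
  qed
  then have "(\<Sum>i=1..n. cinner (component i y) y) = 0" by (intro sum.neutral) blast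
  then have "cinner y y = 0" unfolding cinner_sum_left[symmetric] sum_component .
  then show "y = 0" by simp
qed

text \<open>Both operators are assumed to satisfy the same conditions, so each statement about transport from
  the second space to the first also holds in the opposite direction.\<close>

locale bidiagonal_pair =
  A: bidiagonal_operator n H \<Omega> T t + B: bidiagonal_operator n H' \<Omega> T' t'
  for n :: nat and \<Omega> :: "complex set"
    and H :: "nat \<Rightarrow> 'a::complex_hilbert_space set" and T :: "'a \<Rightarrow> 'a" and t
    and H' :: "nat \<Rightarrow> 'b::complex_hilbert_space set" and T' :: "'b \<Rightarrow> 'b" and t'
begin

text \<open>Transported to the first space, the superdiagonal part of \<open>T'\<close> is a nilpotent operator commuting
  with \<open>T\<close>, so it lowers the flag of \<open>T\<close>. Since \<open>t'\<^sub>k\<close> arises from \<open>t'\<^sub>n\<close> by \<open>n - k\<close>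
  applications of it, the flag of \<open>T'\<close> is carried into the flag of \<open>T\<close>.\<close>

lemma equivalence_maps_flag:
  assumes U: "bounded_clinear U" and V: "bounded_clinear V"
    and VU: "\<And>x. V (U x) = x" and UV: "\<And>y. U (V y) = y" and UT: "\<And>x. U (T x) = T' (U x)"
    and y: "y \<in> B.flag k"
  shows "V y \<in> A.flag k"
proof (cases "k \<le> n")
  case True
  define X where "X x = V (B.superdiag (U x))" for x
  have bX: "bounded_clinear X"
    unfolding X_def
    by (rule bounded_clinear_compose[OF V bounded_clinear_compose[OF B.bounded_superdiag U]])
  have VT: "V (T' y) = T (V y)" for y
    using arg_cong[OF UT[of "V y"], of V] by (simp add: VU UV)
  have NT: "B.superdiag (T' y) = T' (B.superdiag y)" for y
    by (simp add: B.T_eq B.superdiag_linear B.diag_superdiag)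
  have comm: "X (T x) = T (X x)" for x by (simp add: X_def UT NT VT)
  have pow: "(X ^^ m) (V y) = V ((B.superdiag ^^ m) y)" for m y
    by (induction m) (simp_all add: X_def UV)
  have nil: "(X ^^ n) x = 0" for x
    using pow[of n "U x"] by (simp add: VU B.superdiag_nilpotent bounded_clinear_0[OF V])
  have sec: "V (t' i w) \<in> A.flag i" if i: "i \<in> {1..n}" and w: "w \<in> \<Omega>" for i w
  proof -
    have "t' i w = (B.superdiag ^^ (n - i)) (t' n w)"
      using B.superdiag_pow_section[of i "n - i" w] i w by simp
    then have "V (t' i w) = (X ^^ (n - i)) (V (t' n w))" by (simp add: pow)
    also have "\<dots> \<in> A.flag i"
      by (rule A.nilpotent_lowers_flag[OF bX comm nil]) (rule A.flag_n, use i in simp)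
    finally show ?thesis .
  qed
  show ?thesis
  proof (rule B.flag_sum[OF y _ V])
    show "complex_vector.subspace (A.flag k)" using A.closed_flag by (simp add: closed_csubspace_def)
    fix i assume i: "i \<in> {1..n}" "i \<le> k"
    have "V (B.component i y) \<in> A.flag i"
      by (rule B.maps_H_into[OF i(1) V A.closed_flag sec[OF i(1)] B.component_in[OF i(1)]])
    then show "V (B.component i y) \<in> A.flag k" using A.flag_mono[OF i(2)] by blast
  qed
next
  case False
  then show ?thesis by (intro A.flag_n) simp
qed

end

sublocale bidiagonal_pair \<subseteq> swap: bidiagonal_pair n \<Omega> H' T' t' H T t
  by unfold_locales

context bidiagonal_pair
begin

text \<open>A unitary equivalence preserves both flags, hence, being unitary, the orthogonal summands.\<close>

lemma unitary_component:
  assumes U: "unitary U" and UT: "\<And>x. U (T x) = T' (U x)"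
  shows "U (A.component k x) = B.component k (U x)"
proof -
  have bU: "bounded_clinear U" and iso: "\<And>x y. cinner (U x) (U y) = cinner x y"
    using U by (auto simp: unitary_def)
  obtain V where V: "bounded_clinear V" and VU: "\<And>x. V (U x) = x" and UV: "\<And>y. U (V y) = y"
    using unitary_inverse[OF U] by blast
  have VT: "V (T' y) = T (V y)" for y
    using arg_cong[OF UT[of "V y"], of V] by (simp add: VU UV)
  have off: "B.component i (U (A.component k x)) = 0" if "i \<noteq> k" for i k x
  proof (cases "k < i")
    case True
    have "U (A.component k x) \<in> B.flag k"
      by (rule swap.equivalence_maps_flag[OF V bU UV VU VT A.flag_component])
    then show ?thesis using True by (simp add: B.flag_def)
  next
    case False
    let ?y = "U (A.component k x)" let ?z = "B.component i ?y"
    have "V ?z \<in> A.flag i"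
      by (rule equivalence_maps_flag[OF bU V VU UV UT B.flag_component])
    then have 0: "A.component k (V ?z) = 0" using False that by (simp add: A.flag_def)
    have "cinner ?z ?z = cinner ?y ?z"
      using B.cinner_component_left[of i ?y ?y] cinner_commute[of ?y ?z]
      by (simp add: cinner_self)
    also have "\<dots> = cinner (A.component k x) (V ?z)" using iso[of _ "V ?z"] by (simp add: UV)
    also have "\<dots> = 0" using A.cinner_component_left[of k x "V ?z"] 0 by simp
    finally show ?thesis by simp
  qed
  show ?thesis
  proof (rule B.component_eqI)
    fix i assume i: "i \<in> {1..n}"
    have "B.component i (U x) = B.component i (U (\<Sum>j=1..n. A.component j x))"
      by (simp only: A.sum_component)
    also have "\<dots> = (\<Sum>j=1..n. B.component i (U (A.component j x)))"
      by (simp only: bounded_clinear_sum[OF bU] B.component_linear)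
    also have "\<dots> = (\<Sum>j=1..n. if j = i then B.component i (U (A.component i x)) else 0)"
      using off by (intro sum.cong) auto
    also have "\<dots> = B.component i (U (A.component i x))"
      using i by (simp only: sum.delta finite_atLeastAtMost if_True)
    finally have eq: "B.component i (U x) = B.component i (U (A.component i x))" .
    show "B.component i (U (A.component k x)) = B.component i (B.component k (U x))"
      using eq off[of i k x] by (cases "i = k") (simp_all add: B.component_component)
  qed
qed

lemma unitary_intertwines_parts:
  assumes U: "unitary U" and UT: "\<And>x. U (T x) = T' (U x)"
  shows "U (A.diag x) = B.diag (U x)" "U (A.superdiag x) = B.superdiag (U x)"
proof -
  have bU: "bounded_clinear U" using U by (simp add: unitary_def)
  show d: "U (A.diag x) = B.diag (U x)"
    unfolding A.diag_def B.diag_def bounded_clinear_sum[OF bU] A.entry_def B.entry_def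
    by (simp only: unitary_component[OF U UT] UT)
  show "U (A.superdiag x) = B.superdiag (U x)"
    unfolding A.superdiag_def B.superdiag_def bounded_clinear_diff[OF bU] UT d ..
qed

text \<open>The factor relating \<open>U t\<^sub>n\<close> to \<open>t'\<^sub>n\<close> is passed down the whole chain, because \<open>U\<close> intertwines the
  superdiagonal parts.\<close>

lemma unitary_sections:
  assumes U: "unitary U" and UT: "\<And>x. U (T x) = T' (U x)" and n: "1 \<le> n"
  obtains \<psi> where "\<psi> holomorphic_on \<Omega>"
    "\<And>i w. i \<in> {1..n} \<Longrightarrow> w \<in> \<Omega> \<Longrightarrow> U (t i w) = \<psi> w *\<^sub>C t' i w"
proof -
  have bU: "bounded_clinear U" using U by (simp add: unitary_def)
  have nn: "n \<in> {1..n}" using n by simp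
  have line: "\<exists>c. U (t n w) = c *\<^sub>C t' n w" if w: "w \<in> \<Omega>" for w
  proof -
    have "B.component n (U (t n w)) = U (t n w)"
      using unitary_component[OF U UT, of n "t n w"] A.component_section[OF nn w] by simp
    then have "U (t n w) \<in> H' n" using B.H_iff_component[OF nn] by blast
    moreover have "B.diag (U (t n w)) = w *\<^sub>C U (t n w)"
      using unitary_intertwines_parts(1)[OF U UT, of "t n w"] A.diag_section[OF nn w]
      by (simp add: bounded_clinear_scaleC[OF bU])
    ultimately show ?thesis using B.eigenvector_multiple[OF nn w] by blast
  qed
  obtain \<psi> where \<psi>: "\<psi> holomorphic_on \<Omega>" "\<And>w. w \<in> \<Omega> \<Longrightarrow> U (t n w) = \<psi> w *\<^sub>C t' n w"
    by (rule proportional_sections[OF A.open_\<Omega>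
          vector_holomorphic_bounded_clinear[OF bU A.section_holomorphic[OF nn]]
          B.section_holomorphic[OF nn] line B.section_nonzero[OF nn]]) (assumption | (rule that; blast))+
  have pow: "U ((A.superdiag ^^ m) x) = (B.superdiag ^^ m) (U x)" for m x
    by (induction m) (simp_all add: unitary_intertwines_parts(2)[OF U UT])
  have "U (t i w) = \<psi> w *\<^sub>C t' i w" if i: "i \<in> {1..n}" and w: "w \<in> \<Omega>" for i w
  proof -
    have "t i w = (A.superdiag ^^ (n - i)) (t n w)" "t' i w = (B.superdiag ^^ (n - i)) (t' n w)"
      using A.superdiag_pow_section[of i "n - i" w] B.superdiag_pow_section[of i "n - i" w] i w by simp_all
    then show ?thesis
      using bounded_clinear_scaleC[OF bounded_clinear_pow[OF B.bounded_superdiag]]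
      by (simp add: pow \<psi>(2)[OF w])
  qed
  then show ?thesis using that \<psi>(1) by blast
qed

lemma invariants_of_unitary_equivalence:
  assumes "unitarily_equivalent T T'" and n: "1 \<le> n" and w: "w \<in> \<Omega>"
  shows "section_curvature (t n) w = section_curvature (t' n) w"
    and "i \<in> {1..<n} \<Longrightarrow> norm (t i w) / norm (t' i w) = norm (t (i + 1) w) / norm (t' (i + 1) w)"
proof -
  obtain U where U: "unitary U" and UT: "\<And>x. U (T x) = T' (U x)"
    using assms(1) by (auto simp: unitarily_equivalent_def)
  obtain \<psi> where \<psi>: "\<psi> holomorphic_on \<Omega>"
    "\<And>i w. i \<in> {1..n} \<Longrightarrow> w \<in> \<Omega> \<Longrightarrow> U (t i w) = \<psi> w *\<^sub>C t' i w"
    by (rule unitary_sections[OF U UT n]) (assumption | (rule that; blast))+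
  have iso: "norm (U x) = norm x" for x
  proof -
    have "cinner (U x) (U x) = cinner x x" using U by (simp add: unitary_def)
    then show ?thesis by (simp add: cinner_self power2_eq_iff_nonneg del: of_real_power)
  qed
  have norm: "norm (t i w) = cmod (\<psi> w) * norm (t' i w)" if "i \<in> {1..n}" "w \<in> \<Omega>" for i w
    using iso[of "t i w"] \<psi>(2)[OF that] by simp
  have nn: "n \<in> {1..n}" using n by simp
  show "section_curvature (t n) w = section_curvature (t' n) w"
    by (rule section_curvature_cong[OF A.open_\<Omega> A.section_holomorphic[OF nn] B.section_holomorphic[OF nn]
          \<psi>(1) A.section_nonzero[OF nn] norm[OF nn] w])
  have ratio: "norm (t i w) / norm (t' i w) = cmod (\<psi> w)" if i: "i \<in> {1..n}" for i
    using norm[OF i w] B.section_nonzero[OF i w] by simp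
  assume "i \<in> {1..<n}"
  then have "i \<in> {1..n}" "i + 1 \<in> {1..n}" by simp_all
  then show "norm (t i w) / norm (t' i w) = norm (t (i + 1) w) / norm (t' (i + 1) w)"
    by (simp only: ratio)
qed

text \<open>On a disc the two conditions give one holomorphic \<open>\<phi>\<close> with \<open>|t\<^sub>i| = |\<phi>| |t'\<^sub>i|\<close> for all \<open>i\<close>. Polarisation
  and the orthogonality of the summands turn this into equality of the Gram matrices of \<open>t\<^sub>i w\<close>
  and \<open>\<phi> w t'\<^sub>i w\<close>. The resulting unitary intertwines the operators because \<open>T\<close> acts on the
  sections by \<open>T t\<^sub>i = w t\<^sub>i + t\<^sub>i\<^sub>-\<^sub>1\<close>, and likewise \<open>T'\<close>.\<close>

lemma unitary_equivalence_of_invariants: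
  assumes conn: "connected \<Omega>" and n: "1 \<le> n"
    and curv: "\<And>w. w \<in> \<Omega> \<Longrightarrow> section_curvature (t n) w = section_curvature (t' n) w"
    and ratio: "\<And>i w. i \<in> {1..<n} \<Longrightarrow> w \<in> \<Omega> \<Longrightarrow>
      norm (t i w) / norm (t' i w) = norm (t (i + 1) w) / norm (t' (i + 1) w)"
  shows "unitarily_equivalent T T'"
proof -
  have nn: "n \<in> {1..n}" using n by simp
  \<comment> \<open>Radius \<open>0\<close> gives the empty disc, which serves the degenerate case of empty \<open>\<Omega>\<close>.\<close>
  obtain c r where D: "ball c r \<subseteq> \<Omega>" "ball c r = {} \<Longrightarrow> \<Omega> = {}"
  proof (cases "\<Omega> = {}")
    case True
    then show ?thesis using that[of 0 0] by simp
  next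
    case False
    then obtain c where "c \<in> \<Omega>" by blast
    then obtain r where "0 < r" "ball c r \<subseteq> \<Omega>" using A.open_\<Omega> open_contains_ball by blast
    then show ?thesis using that[of c r] by simp
  qed
  let ?D = "ball c r"
  have hol: "vector_holomorphic_on (t i) ?D" "vector_holomorphic_on (t' i) ?D" if "i \<in> {1..n}" for i
    using vector_holomorphic_subset[OF A.section_holomorphic[OF that] D(1)]
      vector_holomorphic_subset[OF B.section_holomorphic[OF that] D(1)] .
  obtain \<phi> where \<phi>: "\<phi> holomorphic_on ?D" "\<And>w. \<phi> w \<noteq> 0"
    "\<And>w. w \<in> ?D \<Longrightarrow> norm (t n w) = cmod (\<phi> w) * norm (t' n w)"
  proof (rule norm_proportional_of_curvature_eq[OF hol(1)[OF nn] hol(2)[OF nn]])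
    fix w assume "w \<in> ?D"
    then have w: "w \<in> \<Omega>" using D(1) by blast
    show "t n w \<noteq> 0" "t' n w \<noteq> 0" "section_curvature (t n) w = section_curvature (t' n) w"
      using A.section_nonzero[OF nn w] B.section_nonzero[OF nn w] curv[OF w] .
  qed blast
  have norm: "norm (t i w) = norm (\<phi> w *\<^sub>C t' i w)" if i: "i \<in> {1..n}" and w: "w \<in> ?D" for i w
  proof -
    have w': "w \<in> \<Omega>" using w D(1) by blast
    have "i \<le> n" using i by simp
    then have "1 \<le> i \<longrightarrow> norm (t i w) / norm (t' i w) = norm (t n w) / norm (t' n w)"
    proof (induction rule: inc_induct)
      case (step j)
      then show ?case using ratio[of j w] w' by auto
    qed simp
    also have "norm (t n w) / norm (t' n w) = cmod (\<phi> w)"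
      using \<phi>(3)[OF w] B.section_nonzero[OF nn w'] by simp
    finally show ?thesis using i B.section_nonzero[OF i w'] by (simp add: divide_eq_eq)
  qed
  define a where "a = (\<lambda>(i, w). 1 *\<^sub>C t i w)"
  define b where "b = (\<lambda>(i, w). \<phi> w *\<^sub>C t' i w)"
  let ?I = "{1..n} \<times> ?D"
  have da: "closure (complex_vector.span (a ` ?I)) = UNIV"
    unfolding a_def by (rule A.dense_sections[OF conn open_ball D]) simp_all
  have db: "closure (complex_vector.span (b ` ?I)) = UNIV"
    unfolding b_def by (rule B.dense_sections[OF conn open_ball D]) (simp_all add: \<phi>(2))
  have gram: "cinner (a p) (a q) = cinner (b p) (b q)" if pq: "p \<in> ?I" "q \<in> ?I" for p q
  proof -
    obtain i w j z where pq': "p = (i, w)" "q = (j, z)" by fastforce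
    then have i: "i \<in> {1..n}" and j: "j \<in> {1..n}" and wz: "w \<in> ?D" "z \<in> ?D" using pq by auto
    have wz': "w \<in> \<Omega>" "z \<in> \<Omega>" using wz D(1) by blast+
    show ?thesis
    proof (cases "i = j")
      case True
      have "cinner (t i w) (t i z) = cinner (\<phi> w *\<^sub>C t' i w) (\<phi> z *\<^sub>C t' i z)"
        by (rule cinner_eq_of_norm_eq[OF hol(1)[OF i] vector_holomorphic_scaleC[OF \<phi>(1) hol(2)[OF i]]
              norm[OF i] wz])
      then show ?thesis using True by (simp add: a_def b_def pq')
    next
      case False
      have "cinner (t i w) (t j z) = 0"
        by (rule A.orthogonal_H[OF i j False A.section_in[OF i wz'(1)] A.section_in[OF j wz'(2)]])
      moreover have "cinner (t' i w) (t' j z) = 0"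
        by (rule B.orthogonal_H[OF i j False B.section_in[OF i wz'(1)] B.section_in[OF j wz'(2)]])
      ultimately show ?thesis by (simp add: a_def b_def pq')
    qed
  qed
  obtain U where U: "unitary U" and Uab: "\<And>p. p \<in> ?I \<Longrightarrow> U (a p) = b p"
    by (rule unitary_of_gram[OF gram da db]) (assumption | (rule that; simp))+
  have bU: "bounded_clinear U" using U by (simp add: unitary_def)
  have Ut: "U (t i w) = \<phi> w *\<^sub>C t' i w" if "i \<in> {1..n}" "w \<in> ?D" for i w
    using Uab[of "(i, w)"] that by (simp add: a_def b_def)
  have "U (T x) = T' (U x)" for x
  proof (rule bounded_clinear_eq_on_closure_span[where S = "a ` ?I"])
    show "bounded_clinear (\<lambda>x. U (T x))" by (rule bounded_clinear_compose[OF bU A.bounded_T])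
    show "bounded_clinear (\<lambda>x. T' (U x))" by (rule bounded_clinear_compose[OF B.bounded_T bU])
    show "x \<in> closure (complex_vector.span (a ` ?I))" by (simp only: da UNIV_I)
    fix y assume "y \<in> a ` ?I"
    then obtain i w where i: "i \<in> {1..n}" and w: "w \<in> ?D" and y: "y = t i w"
      unfolding a_def by auto
    have w': "w \<in> \<Omega>" using w D(1) by blast
    have "U (if i = 1 then 0 else t (i - 1) w) = \<phi> w *\<^sub>C (if i = 1 then 0 else t' (i - 1) w)"
    proof (cases "i = 1")
      case False
      then have "i - 1 \<in> {1..n}" using i by auto
      then show ?thesis using Ut[OF _ w] False by simp
    qed (simp add: bounded_clinear_0[OF bU])
    then have "U (T y) = \<phi> w *\<^sub>C T' (t' i w)"
      unfolding y A.T_section[OF i w'] B.T_section[OF i w']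
      by (simp only: bounded_clinear_add[OF bU] bounded_clinear_scaleC[OF bU] Ut[OF i w]
          scaleC_add_right scaleC_scaleC mult.commute)
    also have "\<dots> = T' (U y)"
      by (simp only: y Ut[OF i w] bounded_clinear_scaleC[OF B.bounded_T])
    finally show "U (T y) = T' (U y)" .
  qed
  then show ?thesis using U unfolding unitarily_equivalent_def by blast
qed

end

theorem theorem3p1:
  fixes \<Omega> :: "complex set" and n :: nat
    and H :: "nat \<Rightarrow> 'a::complex_hilbert_space set" and T :: "'a \<Rightarrow> 'a"
    and H' :: "nat \<Rightarrow> 'b::complex_hilbert_space set" and T' :: "'b \<Rightarrow> 'b"
    and t :: "nat \<Rightarrow> complex \<Rightarrow> 'a" and t' :: "nat \<Rightarrow> complex \<Rightarrow> 'b"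
  assumes "open \<Omega>" and "connected \<Omega>" and "1 \<le> n"
    and "FB_class n \<Omega> H T" and "FB_class n \<Omega> H' T'"
    and "\<forall>i\<in>{1..n}. \<forall>j\<in>{1..n}. i + 2 \<le> j \<longrightarrow> (\<forall>x\<in>H j. matrix_entry H T i j x = 0)"
    and "\<forall>i\<in>{1..n}. \<forall>j\<in>{1..n}. i + 2 \<le> j \<longrightarrow> (\<forall>x\<in>H' j. matrix_entry H' T' i j x = 0)"
    and "\<forall>i\<in>{1..n}. nonvanishing_section \<Omega> (H i) (matrix_entry H T i i) (t i)"
    and "\<forall>i\<in>{1..n}. nonvanishing_section \<Omega> (H' i) (matrix_entry H' T' i i) (t' i)"
    and "\<forall>i\<in>{1..<n}. \<forall>w\<in>\<Omega>. t i w = matrix_entry H T i (i + 1) (t (i + 1) w)"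
    and "\<forall>i\<in>{1..<n}. \<forall>w\<in>\<Omega>. t' i w = matrix_entry H' T' i (i + 1) (t' (i + 1) w)"
  shows "unitarily_equivalent T T' \<longleftrightarrow>
    (\<forall>w\<in>\<Omega>. curvature \<Omega> (H n) (matrix_entry H T n n) w =
            curvature \<Omega> (H' n) (matrix_entry H' T' n n) w) \<and>
    (\<forall>i\<in>{1..<n}. \<forall>w\<in>\<Omega>. norm (t i w) / norm (t' i w) = norm (t (i + 1) w) / norm (t' (i + 1) w))"
proof -
  have dec: "orthogonal_decomposition n H" "orthogonal_decomposition n H'"
    using assms(4,5) by (simp_all only: FB_class_def)
  interpret A: bidiagonal_operator n H \<Omega> T t
    by unfold_locales
      (fact assms(1) assms(4) dec(1) | rule assms(6,8,10)[rule_format], assumption+)+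
  interpret B: bidiagonal_operator n H' \<Omega> T' t'
    by unfold_locales
      (fact assms(1) assms(5) dec(2) | rule assms(7,9,11)[rule_format], assumption+)+
  interpret bidiagonal_pair n \<Omega> H T t H' T' t' by unfold_locales
  have nn: "n \<in> {1..n}" using assms(3) by simp
  show ?thesis
  proof (intro iffI conjI ballI)
    fix w assume eq: "unitarily_equivalent T T'" and w: "w \<in> \<Omega>"
    show "curvature \<Omega> (H n) (matrix_entry H T n n) w = curvature \<Omega> (H' n) (matrix_entry H' T' n n) w"
      unfolding A.curvature_eq_section_curvature[OF nn w] B.curvature_eq_section_curvature[OF nn w]
      by (rule invariants_of_unitary_equivalence(1)[OF eq assms(3) w])
    fix i assume "i \<in> {1..<n}"
    then show "norm (t i w) / norm (t' i w) = norm (t (i + 1) w) / norm (t' (i + 1) w)"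
      by (rule invariants_of_unitary_equivalence(2)[OF eq assms(3) w])
  next
    assume inv: "(\<forall>w\<in>\<Omega>. curvature \<Omega> (H n) (matrix_entry H T n n) w =
            curvature \<Omega> (H' n) (matrix_entry H' T' n n) w) \<and>
      (\<forall>i\<in>{1..<n}. \<forall>w\<in>\<Omega>. norm (t i w) / norm (t' i w) = norm (t (i + 1) w) / norm (t' (i + 1) w))"
    show "unitarily_equivalent T T'"
    proof (rule unitary_equivalence_of_invariants[OF assms(2,3)])
      fix w assume w: "w \<in> \<Omega>"
      show "section_curvature (t n) w = section_curvature (t' n) w"
        using inv w A.curvature_eq_section_curvature[OF nn w] B.curvature_eq_section_curvature[OF nn w]
        by simp
      fix i assume "i \<in> {1..<n}"
      then show "norm (t i w) / norm (t' i w) = norm (t (i + 1) w) / norm (t' (i + 1) w)"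
        using inv w by blast
    qed
  qed
qed

end
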